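(* Let $\sigma=\lambda/\nu$ be a balanced skew shape of height $a$ and width $b$, and let $w\in\mathfrak{S}_n$ be a skew vexillary permutation of shape $\sigma$. Then $\mathrm{ddeg}$ is $ab/(a+b)$-mesic with respect to the action of rowmotion $\mathrm{row}$ on the weak order interval $[e,w]$; that is, the average of $\mathrm{ddeg}$ along every $\mathrm{row}$-orbit of $[e,w]$ is $ab/(a+b)$.
   Context: Weak order: For $w\in\mathfrak{S}_n$, $\mathrm{Inv}(w)=\{(i,j): 1\le i<j\le n,\ w(i)>w(j)\}$ and $\mathrm{Inv}^{-1}(w)=\mathrm{Inv}(w^{-1})$. Weak order on $\mathfrak{S}_n$ is: $u\le w$ iff $\mathrm{Inv}^{-1}(u)\subseteq \mathrm{Inv}^{-1}(w)$; equivalently, it is the partial order whose cover relations are $u\lessdot us_k$ with $u(k)<u(k+1)$, $s_k$ the simple transposition of $k,k+1$. $e$ is the identity; $[e,w]=\{u:e\le u\le w\}$. Every such interval is a finite semidistributive lattice. $\mathrm{ddeg}(p)$ is the number of elements of the poset covered by $p$. Rowmotion: A finite lattice $L$ is semidistributive if every element has a canonical join representation and a canonical meet representation (equivalently, $x\vee y=x\vee z$ implies $x\vee y=x\vee(y\wedge z)$, and dually). For such $L$ and a cover relation $x\lessdot y$, put $\gamma(x\lessdot y)=\min\{z\in L:x\vee z=y\}$, which exists and is join-irreducible. Let $D^\gamma(y)=\{\gamma(x\lessdot y): x\lessdot y\}$ and $U^\gamma(y)=\{\gamma(y\lessdot z): y\lessdot z\}$. Rowmotion is the map $\mathrm{row}\colon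 L\to L$ with $\mathrm{row}(y)$ the unique $x\in L$ such that $D^\gamma(x)=U^\gamma(y)$; it is well defined and invertible (known fact). Homomesy: For an invertible operator $\Phi\colon X\to X$ on a finite set $X$, a statistic $f\colon X\to\mathbb{R}$ is $c$-mesic if the average of $f$ along every $\Phi$-orbit equals $c$. Shapes: A diagram is a finite subset of $\mathbb{Z}^2$ of boxes $(i,j)$ in matrix coordinates ($i$ = row, increasing downwards; $j$ = column, increasing rightwards). A partition $\lambda$ is identified with its Young diagram $\{(i,j):1\le i\le \ell(\lambda),1\le j\le\lambda_i\}$. For partitions with $\nu_i\le\lambda_i$ for all $i$, the skew shape $\sigma=\lambda/\nu$ is the set difference of the Young diagrams. $\sigma$ is connected if the Hasse diagram of the poset on its boxes (with order induced from the componentwise order on $\mathbb{Z}^2$) is connected (in particular nonempty). A connected $\sigma$ has height $a$ and width $b$ if $[a]\times[b]$ is the smallest rectangle containing $\sigma$ up to translation. Translate $\sigma$ into $[a]\times[b]$; its main antidiagonal is the line joining the northeast and southwest corners of the boundary of this rectangle. A corner of $\sigma$ is a point where two line segments that are part of the boundary of $\sigma$ meet; it is outward if no box of $\sigma$ intersects both line segments (except at the corner point). (Equivalently, outward corners are the lattice points, at the southeast corner of position $(p,q)$, such that exactly three of $(p,q),(p,q+1),(p+1,q),(p+1,q+1)$ lie in $\sigma$; such a point is on the main antidiagonal iff $pb+qa=ab$.) $\sigma$ is balanced if it is connected and all its outward corners lie exactly on its main antidiagonal. Skew vexillary: The Rothe diagram of $w$ is $\{(i,w(j)):(i,j)\in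 \mathrm{Inv}(w)\}$. $w$ is skew vexillary of shape $\sigma$ if its Rothe diagram can be transformed to $\sigma$ by some permutation of rows and columns (rows and columns being permuted separately). *)

theory Defs
  imports Complex_Main "HOL-Combinatorics.Permutations" "HOL-Combinatorics.Orbits"
    "HOL-Algebra.Lattice"
begin

section \<open>Covers, labels and rowmotion\<close>

definition covered_by :: "('a, 'm) gorder_scheme \<Rightarrow> 'a \<Rightarrow> 'a \<Rightarrow> bool" where
  "covered_by L x y \<longleftrightarrow> x \<in> carrier L \<and> y \<in> carrier L \<and> x \<sqsubset>\<^bsub>L\<^esub> y \<and>
     \<not> (\<exists>z \<in> carrier L. x \<sqsubset>\<^bsub>L\<^esub> z \<and> z \<sqsubset>\<^bsub>L\<^esub> y)"

definition ddeg :: "('a, 'm) gorder_scheme \<Rightarrow> 'a \<Rightarrow> nat" where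
  "ddeg L p = card {x. covered_by L x p}"

text \<open>The labels and rowmotion below are meant for a finite semidistributive lattice \<open>L\<close>,
  where the minimum and the unique element they describe exist.\<close>

definition gamma :: "('a, 'm) gorder_scheme \<Rightarrow> 'a \<Rightarrow> 'a \<Rightarrow> 'a" where
  "gamma L x y = (THE z. least L z {z \<in> carrier L. x \<squnion>\<^bsub>L\<^esub> z = y})"

definition down_labels :: "('a, 'm) gorder_scheme \<Rightarrow> 'a \<Rightarrow> 'a set" where
  "down_labels L y = {gamma L x y | x. covered_by L x y}"

definition up_labels :: "('a, 'm) gorder_scheme \<Rightarrow> 'a \<Rightarrow> 'a set" where
  "up_labels L y = {gamma L y z | z. covered_by L y z}"

definition row :: "('a, 'm) gorder_scheme \<Rightarrow> 'a \<Rightarrow> 'a" where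
  "row L y = (THE x. x \<in> carrier L \<and> down_labels L x = up_labels L y)"

section \<open>Homomesy\<close>

text \<open>The notion presupposes an invertible operator on a finite set, hence the first two
  conjuncts. Under them the forward orbit \<^const>\<open>orbit\<close> of a point of \<open>X\<close> is its whole orbit.\<close>

definition mesic :: "'a set \<Rightarrow> ('a \<Rightarrow> 'a) \<Rightarrow> ('a \<Rightarrow> real) \<Rightarrow> real \<Rightarrow> bool" where
  "mesic X \<Phi> f c \<longleftrightarrow> finite X \<and> bij_betw \<Phi> X X \<and>
     (\<forall>x \<in> X. (\<Sum>y \<in> orbit \<Phi> x. f y) / real (card (orbit \<Phi> x)) = c)"

section \<open>Weak order on the symmetric group\<close>

definition Inv :: "nat \<Rightarrow> (nat \<Rightarrow> nat) \<Rightarrow> (nat \<times> nat) set" where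
  "Inv n w = {(i, j). 1 \<le> i \<and> i < j \<and> j \<le> n \<and> w i > w j}"

definition weak_le :: "nat \<Rightarrow> (nat \<Rightarrow> nat) \<Rightarrow> (nat \<Rightarrow> nat) \<Rightarrow> bool" where
  "weak_le n u w \<longleftrightarrow> Inv n (inv u) \<subseteq> Inv n (inv w)"

definition weak_interval :: "nat \<Rightarrow> (nat \<Rightarrow> nat) \<Rightarrow> (nat \<Rightarrow> nat) gorder" where
  "weak_interval n w =
     \<lparr>carrier = {u. u permutes {1..n} \<and> weak_le n id u \<and> weak_le n u w},
      eq = (=), le = weak_le n\<rparr>"

section \<open>Partitions and skew shapes\<close>

type_synonym diagram = "(int \<times> int) set"

definition is_partition :: "nat list \<Rightarrow> bool" where
  "is_partition lam \<longleftrightarrow> sorted_wrt (\<ge>) lam \<and> (\<forall>x \<in> set lam. 0 < x)"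

text \<open>The \<open>i\<close>-th part, counted from \<open>1\<close> and padded by zeros.\<close>

definition part :: "nat list \<Rightarrow> nat \<Rightarrow> nat" where
  "part lam i = (if 1 \<le> i \<and> i \<le> length lam then lam ! (i - 1) else 0)"

definition young_diagram :: "nat list \<Rightarrow> diagram" where
  "young_diagram lam =
     {(int i, int j) | i j. 1 \<le> i \<and> i \<le> length lam \<and> 1 \<le> j \<and> j \<le> part lam i}"

definition skew_shape :: "nat list \<Rightarrow> nat list \<Rightarrow> diagram" where
  "skew_shape lam nu = young_diagram lam - young_diagram nu"

definition box_poset :: "diagram \<Rightarrow> (int \<times> int) gorder" where
  "box_poset \<sigma> = \<lparr>carrier = \<sigma>, eq = (=), le = (\<lambda>x y. fst x \<le> fst y \<and> snd x \<le> snd y)\<rparr>"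

definition connected_diagram :: "diagram \<Rightarrow> bool" where
  "connected_diagram \<sigma> \<longleftrightarrow> \<sigma> \<noteq> {} \<and>
     (\<forall>x \<in> \<sigma>. \<forall>y \<in> \<sigma>.
        (x, y) \<in> {(u, v). covered_by (box_poset \<sigma>) u v \<or> covered_by (box_poset \<sigma>) v u}\<^sup>*)"

definition translate :: "int \<Rightarrow> int \<Rightarrow> diagram \<Rightarrow> diagram" where
  "translate r c \<sigma> = (\<lambda>(i, j). (i + r, j + c)) ` \<sigma>"

definition rectangle :: "nat \<Rightarrow> nat \<Rightarrow> diagram" where
  "rectangle a b = {1..int a} \<times> {1..int b}"

definition has_height_width :: "diagram \<Rightarrow> nat \<Rightarrow> nat \<Rightarrow> bool" where
  "has_height_width \<sigma> a b \<longleftrightarrow>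
     (\<exists>r c. translate r c \<sigma> \<subseteq> rectangle a b) \<and>
     (\<forall>a' b'. (\<exists>r c. translate r c \<sigma> \<subseteq> rectangle a' b') \<longrightarrow> a \<le> a' \<and> b \<le> b')"

section \<open>Outward corners and balanced shapes\<close>

text \<open>The lattice point \<open>(p, q)\<close> is the southeast corner of the box \<open>(p, q)\<close>. The boundary of a
  diagram consists of the unit segments that are an edge of exactly one of its boxes.\<close>

definition box_points :: "int \<times> int \<Rightarrow> (int \<times> int) set" where
  "box_points x = {fst x - 1, fst x} \<times> {snd x - 1, snd x}"

definition boundary_segment :: "diagram \<Rightarrow> int \<times> int \<Rightarrow> int \<times> int \<Rightarrow> bool" where
  "boundary_segment \<sigma> P Q \<longleftrightarrow>
     \<bar>fst P - fst Q\<bar> + \<bar>snd P - snd Q\<bar> = 1 \<and> (\<exists>!x. x \<in> \<sigma> \<and> P \<in> box_points x \<and> Q \<in> box_points x)"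

text \<open>A horizontal segment \<open>PQ\<close> and a vertical segment \<open>PR\<close> of the boundary meet in the corner \<open>P\<close>.
  A box meets the unit segment \<open>PQ\<close> outside \<open>P\<close> iff it contains its other endpoint \<open>Q\<close>.\<close>

definition outward_corner :: "diagram \<Rightarrow> int \<times> int \<Rightarrow> bool" where
  "outward_corner \<sigma> P \<longleftrightarrow>
     (\<exists>Q R. fst Q = fst P \<and> snd R = snd P \<and> boundary_segment \<sigma> P Q \<and> boundary_segment \<sigma> P R \<and>
        \<not> (\<exists>x \<in> \<sigma>. Q \<in> box_points x \<and> R \<in> box_points x))"

text \<open>In the rectangle \<open>[a] \<times> [b]\<close> the antidiagonal joins the lattice points \<open>(0, b)\<close> and
  \<open>(a, 0)\<close>.\<close>

definition on_antidiagonal :: "nat \<Rightarrow> nat \<Rightarrow> int \<times> int \<Rightarrow> bool" where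
  "on_antidiagonal a b P \<longleftrightarrow> fst P * int b + snd P * int a = int a * int b"

definition balanced :: "diagram \<Rightarrow> bool" where
  "balanced \<sigma> \<longleftrightarrow> connected_diagram \<sigma> \<and>
     (\<forall>a b r c P. has_height_width \<sigma> a b \<and> translate r c \<sigma> \<subseteq> rectangle a b \<and>
        outward_corner (translate r c \<sigma>) P \<longrightarrow> on_antidiagonal a b P)"

section \<open>Skew vexillary permutations\<close>

definition rothe_diagram :: "nat \<Rightarrow> (nat \<Rightarrow> nat) \<Rightarrow> diagram" where
  "rothe_diagram n w = {(int i, int (w j)) | i j. (i, j) \<in> Inv n w}"

text \<open>The rows and columns permuted are those of the whole plane, so that the condition depends on
  \<open>\<sigma>\<close> only up to inserting or deleting empty rows and columns.\<close>

definition skew_vexillary :: "nat \<Rightarrow> (nat \<Rightarrow> nat) \<Rightarrow> diagram \<Rightarrow> bool" where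
  "skew_vexillary n w \<sigma> \<longleftrightarrow>
     (\<exists>f g :: int \<Rightarrow> int. bij f \<and> bij g \<and> (\<lambda>(i, j). (f i, g j)) ` rothe_diagram n w = \<sigma>)"

section \<open>Outward corners of connected skew shapes\<close>

text \<open>At an outward corner of a connected skew shape exactly three of the four surrounding boxes are
  present: see the last lemma.\<close>

lemma ex1_of_two:
  assumes "\<And>x. P x \<longleftrightarrow> x = u \<or> x = v" and "u \<noteq> v"
  shows "(\<exists>!x. x \<in> A \<and> P x) \<longleftrightarrow> (u \<in> A) \<noteq> (v \<in> A)"
  unfolding assms(1) using assms(2) by blast

lemma boundary_segment_east:
  "boundary_segment \<sigma> (p, q) (p, q + 1) \<longleftrightarrow> ((p, q + 1) \<in> \<sigma>) \<noteq> ((p + 1, q + 1) \<in> \<sigma>)"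
proof -
  have "(p, q) \<in> box_points x \<and> (p, q + 1) \<in> box_points x \<longleftrightarrow> x = (p, q + 1) \<or> x = (p + 1, q + 1)" for x
    by (cases x) (auto simp: box_points_def)
  from ex1_of_two[OF this] show ?thesis by (simp add: boundary_segment_def)
qed

lemma boundary_segment_west:
  "boundary_segment \<sigma> (p, q) (p, q - 1) \<longleftrightarrow> ((p, q) \<in> \<sigma>) \<noteq> ((p + 1, q) \<in> \<sigma>)"
proof -
  have "(p, q) \<in> box_points x \<and> (p, q - 1) \<in> box_points x \<longleftrightarrow> x = (p, q) \<or> x = (p + 1, q)" for x
    by (cases x) (auto simp: box_points_def)
  from ex1_of_two[OF this] show ?thesis by (simp add: boundary_segment_def)
qed

lemma boundary_segment_south:
  "boundary_segment \<sigma> (p, q) (p + 1, q) \<longleftrightarrow> ((p + 1, q) \<in> \<sigma>) \<noteq> ((p + 1, q + 1) \<in> \<sigma>)"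
proof -
  have "(p, q) \<in> box_points x \<and> (p + 1, q) \<in> box_points x \<longleftrightarrow> x = (p + 1, q) \<or> x = (p + 1, q + 1)" for x
    by (cases x) (auto simp: box_points_def)
  from ex1_of_two[OF this] show ?thesis by (simp add: boundary_segment_def)
qed

lemma boundary_segment_north:
  "boundary_segment \<sigma> (p, q) (p - 1, q) \<longleftrightarrow> ((p, q) \<in> \<sigma>) \<noteq> ((p, q + 1) \<in> \<sigma>)"
proof -
  have "(p, q) \<in> box_points x \<and> (p - 1, q) \<in> box_points x \<longleftrightarrow> x = (p, q) \<or> x = (p, q + 1)" for x
    by (cases x) (auto simp: box_points_def)
  from ex1_of_two[OF this] show ?thesis by (simp add: boundary_segment_def)
qed

lemma outward_corner_cases:
  "outward_corner \<sigma> (p, q) \<longleftrightarrow>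
     (\<exists>d \<in> {1, -1}. \<exists>e \<in> {1, -1}.
        boundary_segment \<sigma> (p, q) (p, q + d) \<and> boundary_segment \<sigma> (p, q) (p + e, q) \<and>
        \<not> (\<exists>x \<in> \<sigma>. (p, q + d) \<in> box_points x \<and> (p + e, q) \<in> box_points x))"
    (is "_ \<longleftrightarrow> ?R")
proof
  assume "outward_corner \<sigma> (p, q)"
  then obtain Q R where *: "fst Q = p" "snd R = q" "boundary_segment \<sigma> (p, q) Q"
    "boundary_segment \<sigma> (p, q) R" "\<not> (\<exists>x \<in> \<sigma>. Q \<in> box_points x \<and> R \<in> box_points x)"
    by (auto simp: outward_corner_def)
  have "\<bar>snd Q - q\<bar> = 1" "\<bar>fst R - p\<bar> = 1"
    using * by (auto simp: boundary_segment_def)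
  then have "snd Q - q \<in> {1, -1}" "fst R - p \<in> {1, -1}" by auto
  moreover have "Q = (p, q + (snd Q - q))" "R = (p + (fst R - p), q)"
    using * by (auto simp: prod_eq_iff)
  ultimately show ?R using *(3-5) by metis
next
  assume ?R
  then obtain d e where "boundary_segment \<sigma> (p, q) (p, q + d)"
    "boundary_segment \<sigma> (p, q) (p + e, q)"
    "\<not> (\<exists>x \<in> \<sigma>. (p, q + d) \<in> box_points x \<and> (p + e, q) \<in> box_points x)"
    by blast
  then show "outward_corner \<sigma> (p, q)"
    unfolding outward_corner_def by (intro exI[of _ "(p, q + d)"] exI[of _ "(p + e, q)"]) simp
qed

lemma no_common_box:
  "(\<exists>x \<in> \<sigma>. (p, q + 1) \<in> box_points x \<and> (p + 1, q) \<in> box_points x) \<longleftrightarrow> (p + 1, q + 1) \<in> \<sigma>"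
  "(\<exists>x \<in> \<sigma>. (p, q + 1) \<in> box_points x \<and> (p - 1, q) \<in> box_points x) \<longleftrightarrow> (p, q + 1) \<in> \<sigma>"
  "(\<exists>x \<in> \<sigma>. (p, q - 1) \<in> box_points x \<and> (p + 1, q) \<in> box_points x) \<longleftrightarrow> (p + 1, q) \<in> \<sigma>"
  "(\<exists>x \<in> \<sigma>. (p, q - 1) \<in> box_points x \<and> (p - 1, q) \<in> box_points x) \<longleftrightarrow> (p, q) \<in> \<sigma>"
proof -
  have 1: "(p, q + 1) \<in> box_points x \<and> (p + 1, q) \<in> box_points x \<longleftrightarrow> x = (p + 1, q + 1)"
    and 2: "(p, q + 1) \<in> box_points x \<and> (p - 1, q) \<in> box_points x \<longleftrightarrow> x = (p, q + 1)"
    and 3: "(p, q - 1) \<in> box_points x \<and> (p + 1, q) \<in> box_points x \<longleftrightarrow> x = (p + 1, q)"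
    and 4: "(p, q - 1) \<in> box_points x \<and> (p - 1, q) \<in> box_points x \<longleftrightarrow> x = (p, q)" for x
    by (cases x; auto simp: box_points_def)+
  show "(\<exists>x \<in> \<sigma>. (p, q + 1) \<in> box_points x \<and> (p + 1, q) \<in> box_points x) \<longleftrightarrow> (p + 1, q + 1) \<in> \<sigma>"
    "(\<exists>x \<in> \<sigma>. (p, q + 1) \<in> box_points x \<and> (p - 1, q) \<in> box_points x) \<longleftrightarrow> (p, q + 1) \<in> \<sigma>"
    "(\<exists>x \<in> \<sigma>. (p, q - 1) \<in> box_points x \<and> (p + 1, q) \<in> box_points x) \<longleftrightarrow> (p + 1, q) \<in> \<sigma>"
    "(\<exists>x \<in> \<sigma>. (p, q - 1) \<in> box_points x \<and> (p - 1, q) \<in> box_points x) \<longleftrightarrow> (p, q) \<in> \<sigma>"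
    unfolding 1 2 3 4 by blast+
qed

lemma outward_corner_iff:
  "outward_corner \<sigma> (p, q) \<longleftrightarrow>
     ((p, q + 1) \<in> \<sigma> \<and> (p + 1, q) \<in> \<sigma> \<and> \<not> ((p, q) \<in> \<sigma> \<and> (p + 1, q + 1) \<in> \<sigma>)) \<or>
     ((p, q) \<in> \<sigma> \<and> (p + 1, q + 1) \<in> \<sigma> \<and> \<not> ((p, q + 1) \<in> \<sigma> \<and> (p + 1, q) \<in> \<sigma>))"
  using boundary_segment_east[of \<sigma> p q] boundary_segment_west[of \<sigma> p q]
    boundary_segment_south[of \<sigma> p q] boundary_segment_north[of \<sigma> p q] no_common_box[of \<sigma> p q]
  unfolding outward_corner_cases by auto

lemma part_antimono:
  assumes "is_partition lam" "1 \<le> i" "i \<le> k"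
  shows "part lam k \<le> part lam i"
proof (cases "i < k \<and> k \<le> length lam")
  case True
  then have "lam ! (i - 1) \<ge> lam ! (k - 1)"
    using assms sorted_wrt_nth_less[of "(\<ge>)" lam "i - 1" "k - 1"]
    by (auto simp: is_partition_def)
  then show ?thesis using True assms by (auto simp: part_def)
qed (use assms in \<open>auto simp: part_def\<close>)

lemma skew_shape_iff:
  "(x, y) \<in> skew_shape lam nu \<longleftrightarrow>
     1 \<le> x \<and> int (part nu (nat x)) < y \<and> y \<le> int (part lam (nat x))"
proof -
  have Y: "(x, y) \<in> young_diagram mu \<longleftrightarrow> 1 \<le> x \<and> 1 \<le> y \<and> y \<le> int (part mu (nat x))" for mu
  proof
    assume "(x, y) \<in> young_diagram mu"
    then show "1 \<le> x \<and> 1 \<le> y \<and> y \<le> int (part mu (nat x))" by (auto simp: young_diagram_def)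
  next
    assume h: "1 \<le> x \<and> 1 \<le> y \<and> y \<le> int (part mu (nat x))"
    then have "nat x \<le> length mu" by (auto simp: part_def split: if_splits)
    with h have "x = int (nat x) \<and> y = int (nat y) \<and> 1 \<le> nat x \<and> nat x \<le> length mu \<and> 1 \<le> nat y \<and>
      nat y \<le> part mu (nat x)" by auto
    then show "(x, y) \<in> young_diagram mu" unfolding young_diagram_def by blast
  qed
  show ?thesis by (auto simp: skew_shape_def Y)
qed

lemma skew_shape_convex:
  assumes "is_partition lam" "is_partition nu"
    and "(i, j) \<in> skew_shape lam nu" "(k, l) \<in> skew_shape lam nu"
    and "i \<le> x" "x \<le> k" "j \<le> y" "y \<le> l"
  shows "(x, y) \<in> skew_shape lam nu"
proof -
  have "part nu (nat x) \<le> part nu (nat i)" "part lam (nat k) \<le> part lam (nat x)"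
    using assms by (auto intro!: part_antimono simp: skew_shape_iff)
  then show ?thesis using assms by (auto simp: skew_shape_iff)
qed

lemma skew_shape_no_antidiagonal_pair:
  assumes "is_partition lam" "is_partition nu" "connected_diagram (skew_shape lam nu)"
    and B: "(p, q + 1) \<in> skew_shape lam nu" and C: "(p + 1, q) \<in> skew_shape lam nu"
  shows "(p, q) \<in> skew_shape lam nu \<or> (p + 1, q + 1) \<in> skew_shape lam nu"
proof (rule ccontr)
  let ?s = "skew_shape lam nu"
  assume "\<not> ?thesis"
  then have A: "(p, q) \<notin> ?s" and D: "(p + 1, q + 1) \<notin> ?s" by auto
  have nup: "int (part nu (nat p)) = q" and lamp: "int (part lam (nat (p + 1))) = q" and p1: "1 \<le> p"
    using A B C D by (auto simp: skew_shape_iff)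
  have up: "q < snd x" if "x \<in> ?s" "fst x \<le> p" for x
  proof -
    have "part nu (nat p) \<le> part nu (nat (fst x))"
      using assms that by (cases x) (auto intro!: part_antimono simp: skew_shape_iff)
    then show ?thesis using that nup by (cases x) (auto simp: skew_shape_iff)
  qed
  have dn: "snd x \<le> q" if "x \<in> ?s" "p < fst x" for x
  proof -
    have "part lam (nat (fst x)) \<le> part lam (nat (p + 1))"
      using assms that p1 by (cases x) (auto intro!: part_antimono simp: skew_shape_iff)
    then show ?thesis using that lamp by (cases x) (auto simp: skew_shape_iff)
  qed
  let ?E = "{(u, v). covered_by (box_poset ?s) u v \<or> covered_by (box_poset ?s) v u}"
  have step: "fst v \<le> p" if "(u, v) \<in> ?E" "fst u \<le> p" for u v
  proof (rule ccontr)
    assume "\<not> fst v \<le> p"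
    moreover have "u \<in> ?s" "v \<in> ?s"
      "(fst u \<le> fst v \<and> snd u \<le> snd v) \<or> (fst v \<le> fst u \<and> snd v \<le> snd u)"
      using that(1) by (auto simp: covered_by_def box_poset_def lless_def)
    ultimately show False using up[of u] dn[of v] that(2) by auto
  qed
  have "((p, q + 1), (p + 1, q)) \<in> ?E\<^sup>*"
    using assms(3) B C by (auto simp: connected_diagram_def)
  then have "fst (p + 1, q) \<le> p"
    by (induction rule: rtrancl_induct) (use step in auto)
  then show False by simp
qed

lemma outward_corner_skew_shape:
  assumes "is_partition lam" "is_partition nu" "connected_diagram (skew_shape lam nu)"
  shows "outward_corner (skew_shape lam nu) (p, q) \<longleftrightarrow>
    card ({(p, q), (p, q + 1), (p + 1, q), (p + 1, q + 1)} \<inter> skew_shape lam nu) = 3"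
proof -
  let ?s = "skew_shape lam nu"
  have 1: "(p, q) \<in> ?s \<Longrightarrow> (p + 1, q + 1) \<in> ?s \<Longrightarrow> (p, q + 1) \<in> ?s \<and> (p + 1, q) \<in> ?s"
    using skew_shape_convex[OF assms(1,2), of p q "p + 1" "q + 1"] by auto
  have 2: "(p, q + 1) \<in> ?s \<Longrightarrow> (p + 1, q) \<in> ?s \<Longrightarrow> (p, q) \<in> ?s \<or> (p + 1, q + 1) \<in> ?s"
    using skew_shape_no_antidiagonal_pair[OF assms] by auto
  show ?thesis using 1 2
    by (cases "(p, q) \<in> ?s"; cases "(p, q + 1) \<in> ?s"; cases "(p + 1, q) \<in> ?s";
      cases "(p + 1, q + 1) \<in> ?s") (simp_all add: outward_corner_iff)
qed

end

theory Submission
  imports Defs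
begin

text \<open>A cover \<open>x \<lessdot> y\<close> of weak order exchanges adjacent values \<open>p < q\<close>, and its label \<open>\<gamma>(x \<lessdot> y)\<close> amounts
  to the arc \<open>(p, q, A)\<close>, where \<open>A\<close> is the set of values between \<open>p\<close> and \<open>q\<close> that stand to their left.
  Rowmotion turns the arcs of the allowed ascents into the arcs of the descents, so along an orbit
  every function of arcs has the same sum over ascents as over descents.

  Let \<open>I\<close> be the inversion set of \<open>w\<close>, with the inverted values \<open>p < q\<close> as the box in row \<open>q\<close> and
  column \<open>p\<close>. Suppose that the column set \<open>X\<close> of row \<open>q\<close> and the row set \<open>Y\<close> of column \<open>p\<close> satisfy
  \<open>X \<times> Y \<subseteq> I\<close>. Then every value that stands weakly between \<open>p\<close> and \<open>q\<close> in a word \<open>u \<in> [e, w]\<close> lies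
  in exactly one of \<open>X\<close> and \<open>Y\<close>, and the steps from \<open>X\<close> to \<open>Y\<close> in this stretch are allowed ascents
  while those from \<open>Y\<close> to \<open>X\<close> are descents. Counting them with signs shows that, on average over an
  orbit, the descents in row \<open>q\<close> and those in column \<open>p\<close> add up to one.

  In a balanced shape every box crossed by the main antidiagonal has this property. Cutting the
  antidiagonal into \<open>ab\<close> equal pieces, each row contains \<open>b\<close> and each column \<open>a\<close> of them, so the
  mean number \<open>D\<close> of descents satisfies \<open>bD + aD = ab\<close>.\<close>

section \<open>Inversion sets of values\<close>

text \<open>Reading \<open>u\<close> as the word \<open>u 1, ..., u n\<close>, the number
  \<open>inv u x\<close> is the position of the value \<open>x\<close>. Pairs carry the smaller
  value first, and weak order is inclusion of these sets.\<close>

definition vinv :: "nat \<Rightarrow> (nat \<Rightarrow> nat) \<Rightarrow> (nat \<times> nat) set" where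
  "vinv n u = Inv n (inv u)"

lemma vinv_iff: "(p, q) \<in> vinv n u \<longleftrightarrow> 1 \<le> p \<and> p < q \<and> q \<le> n \<and> inv u q < inv u p"
  by (auto simp: vinv_def Inv_def)

lemma vinv_trans: "(p, q) \<in> vinv n u \<Longrightarrow> (q, r) \<in> vinv n u \<Longrightarrow> (p, r) \<in> vinv n u"
  by (auto simp: vinv_iff)

lemma trans_vinv: "trans (vinv n u)"
  by (auto intro: transI vinv_trans)

lemma vinv_coclosed:
  assumes "(p, r) \<in> vinv n u" "p < q" "q < r"
  shows "(p, q) \<in> vinv n u \<or> (q, r) \<in> vinv n u"
  using assms by (auto simp: vinv_iff)

lemma finite_vinv: "finite (vinv n u)"
  by (rule finite_subset[of _ "{1..n} \<times> {1..n}"]) (auto simp: vinv_iff)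

lemma pos_eq_iff: "u permutes S \<Longrightarrow> inv u x = inv u y \<longleftrightarrow> x = y"
  by (metis permutes_inverses(1))

lemma pos_in_iff: "u permutes S \<Longrightarrow> inv u x \<in> S \<longleftrightarrow> x \<in> S"
  using permutes_in_image[OF permutes_inv] by metis

text \<open>Recovers positions from relative order: the values weakly left of \<open>x\<close> form
  the image of \<open>{1..inv u x}\<close> under \<open>u\<close>.\<close>

lemma pos_eq_card:
  assumes u: "u permutes {1..n}" and x: "x \<in> {1..n}"
  shows "inv u x = card {y \<in> {1..n}. inv u y \<le> inv u x}"
proof -
  have "{y \<in> {1..n}. inv u y \<le> inv u x} = u ` {1..inv u x}"
  proof (intro equalityI subsetI)
    fix y assume "y \<in> {y \<in> {1..n}. inv u y \<le> inv u x}"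
    then have "y = u (inv u y)" "inv u y \<in> {1..inv u x}"
      using u pos_in_iff[OF u, of y] by (auto simp: permutes_inverses)
    then show "y \<in> u ` {1..inv u x}" by blast
  next
    fix y assume "y \<in> u ` {1..inv u x}"
    then obtain k where k: "y = u k" "1 \<le> k" "k \<le> inv u x" by auto
    moreover have "inv u x \<le> n" using pos_in_iff[OF u, of x] x by auto
    ultimately show "y \<in> {y \<in> {1..n}. inv u y \<le> inv u x}"
      using u permutes_in_image[OF u, of k] by (auto simp: permutes_inverses)
  qed
  then show ?thesis using card_image[OF permutes_inj_on[OF u]] by simp
qed

section \<open>Permutations as transitive and cotransitive sets of pairs\<close>

lemma vinv_inject:
  assumes u: "u permutes {1..n}" and v: "v permutes {1..n}" and eq: "vinv n u = vinv n v"
  shows "u = v"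
proof -
  have le: "inv u y \<le> inv u x \<longleftrightarrow> inv v y \<le> inv v x" if "x \<in> {1..n}" "y \<in> {1..n}" for x y
  proof (cases x y rule: linorder_cases)
    case less
    then have "inv u y < inv u x \<longleftrightarrow> inv v y < inv v x"
      using eq that vinv_iff[of x y n u] vinv_iff[of x y n v] by auto
    then show ?thesis using less pos_eq_iff[OF u, of x y] pos_eq_iff[OF v, of x y] by linarith
  next
    case greater
    then have "inv u x < inv u y \<longleftrightarrow> inv v x < inv v y"
      using eq that vinv_iff[of y x n u] vinv_iff[of y x n v] by auto
    then show ?thesis by linarith
  qed simp
  have "inv u x = inv v x" for x
  proof (cases "x \<in> {1..n}")
    case True
    have "{y \<in> {1..n}. inv u y \<le> inv u x} = {y \<in> {1..n}. inv v y \<le> inv v x}"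
      using le[OF True] by blast
    then show ?thesis using pos_eq_card[OF u True] pos_eq_card[OF v True] by simp
  next
    case False
    then show ?thesis using permutes_inv[OF u] permutes_inv[OF v] by (simp add: permutes_not_in)
  qed
  then have "inv (inv u) = inv (inv v)" by presburger
  then show ?thesis using u v by (simp add: inv_inv_eq permutes_bij)
qed

text \<open>Reversing the natural order exactly on the pairs of \<open>S\<close> gives the relation
  \<open>le\<close>. Transitivity and the splitting condition make it a linear order, whose ranks
  are the positions in the wanted word.\<close>

lemma vinv_exists:
  assumes sub: "\<And>p q. (p, q) \<in> S \<Longrightarrow> 1 \<le> p \<and> p < q \<and> q \<le> n"
    and tr: "trans S"
    and co: "\<And>p q r. (p, r) \<in> S \<Longrightarrow> p < q \<Longrightarrow> q < r \<Longrightarrow> (p, q) \<in> S \<or> (q, r) \<in> S"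
  shows "\<exists>u. u permutes {1..n} \<and> vinv n u = S"
proof -
  define le where "le x y \<longleftrightarrow> x = y \<or> x < y \<and> (x, y) \<notin> S \<or> (y, x) \<in> S" for x y :: nat
  have lt: "(x, y) \<in> S \<Longrightarrow> x < y" for x y using sub by blast
  have tr': "(x, y) \<in> S \<Longrightarrow> (y, z) \<in> S \<Longrightarrow> (x, z) \<in> S" for x y z using tr by (rule transD)
  have le_trans: "le x z" if xy: "le x y" and yz: "le y z" for x y z
  proof (cases "x = y \<or> y = z \<or> x = z")
    case True
    then show ?thesis using that by (auto simp: le_def)
  next
    case False
    then have xy': "x < y \<and> (x, y) \<notin> S \<or> y < x \<and> (y, x) \<in> S"
      and yz': "y < z \<and> (y, z) \<notin> S \<or> z < y \<and> (z, y) \<in> S"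
      using xy yz lt by (auto simp: le_def)
    consider "x < z" | "z < x" using False by linarith
    then show ?thesis
    proof cases
      case 1
      have "(x, z) \<notin> S"
        using xy' yz' tr'[of x z y] tr'[of y x z] co[of x z y] 1 by auto
      then show ?thesis using 1 by (simp add: le_def)
    next
      case 2
      have "(z, x) \<in> S"
        using xy' yz' tr'[of z y x] co[of z y x] co[of y x z] 2 by auto
      then show ?thesis by (simp add: le_def)
    qed
  qed
  have antisym: "x = y" if "le x y" "le y x" for x y
    using that lt[of x y] lt[of y x] unfolding le_def by auto
  have total: "le x y \<or> le y x" for x y
    unfolding le_def by auto
  \<comment> \<open>\<open>r\<close> becomes the inverse of the wanted permutation; the default
    \<open>x\<close> makes it fix all points outside \<open>{1..n}\<close>.\<close>
  define r where "r x = (if x \<in> {1..n} then card {y \<in> {1..n}. le y x} else x)" for x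
  have mono: "r x < r y" if "le x y" "x \<noteq> y" "x \<in> {1..n}" "y \<in> {1..n}" for x y
  proof -
    have "{z \<in> {1..n}. le z x} \<subset> {z \<in> {1..n}. le z y}"
    proof
      show "{z \<in> {1..n}. le z x} \<subseteq> {z \<in> {1..n}. le z y}" using le_trans that(1) by blast
      have "y \<in> {z \<in> {1..n}. le z y}" "y \<notin> {z \<in> {1..n}. le z x}"
        using that antisym[of x y] by (auto simp: le_def)
      then show "{z \<in> {1..n}. le z x} \<noteq> {z \<in> {1..n}. le z y}" by blast
    qed
    then show ?thesis using that by (auto simp: r_def intro!: psubset_card_mono)
  qed
  have inj: "inj_on r {1..n}"
    by (rule inj_onI) (use mono total in \<open>metis less_irrefl\<close>)
  have "r x \<in> {1..n}" if "x \<in> {1..n}" for x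
  proof -
    have "card {y \<in> {1..n}. le y x} \<le> card {1..n}" by (rule card_mono) auto
    then have "r x \<le> n" using that by (simp add: r_def)
    moreover have "x \<in> {y \<in> {1..n}. le y x}" using that by (simp add: le_def)
    then have "0 < r x" using that by (auto simp: r_def card_gt_0_iff)
    ultimately show ?thesis by simp
  qed
  then have "r ` {1..n} \<subseteq> {1..n}" by blast
  then have "r ` {1..n} = {1..n}" using inj by (simp add: endo_inj_surj)
  then have perm: "r permutes {1..n}"
    using inj by (intro bij_imp_permutes) (auto simp: bij_betw_def r_def)
  have "inv (inv r) = r" using perm by (simp add: inv_inv_eq permutes_bij)
  moreover have "(p, q) \<in> S \<longleftrightarrow> 1 \<le> p \<and> p < q \<and> q \<le> n \<and> r q < r p" for p q
  proof
    assume "(p, q) \<in> S"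
    then show "1 \<le> p \<and> p < q \<and> q \<le> n \<and> r q < r p"
      using sub[of p q] mono[of q p] by (auto simp: le_def)
  next
    assume h: "1 \<le> p \<and> p < q \<and> q \<le> n \<and> r q < r p"
    then have "\<not> le p q" using mono[of p q] by auto
    then show "(p, q) \<in> S" using h by (auto simp: le_def)
  qed
  ultimately have "vinv n (inv r) = S" by (auto simp: vinv_iff)
  then show ?thesis using permutes_inv[OF perm] by blast
qed

section \<open>Exchanges of neighbouring values\<close>

lemma inv_transpose_comp:
  assumes "u permutes S"
  shows "inv (transpose p q \<circ> u) x = inv u (transpose p q x)"
  using assms by (simp add: o_inv_distrib permutes_bij)

text \<open>No third value stands between \<open>p\<close> and \<open>q\<close>, so the exchange
  changes the relative order of this one pair only.\<close>

lemma vinv_swap_up: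
  assumes u: "u permutes {1..n}" and adj: "inv u q = Suc (inv u p)"
    and pq: "1 \<le> p" "p < q" "q \<le> n"
  shows "transpose p q \<circ> u permutes {1..n}"
    and "vinv n (transpose p q \<circ> u) = insert (p, q) (vinv n u)" "(p, q) \<notin> vinv n u"
proof -
  show "transpose p q \<circ> u permutes {1..n}"
    using pq by (intro permutes_compose[OF u] permutes_swap_id) auto
  show "(p, q) \<notin> vinv n u" using adj by (auto simp: vinv_iff)
  have ne: "inv u x = inv u p \<longleftrightarrow> x = p" "inv u x = inv u q \<longleftrightarrow> x = q" for x
    using pos_eq_iff[OF u] by auto
  have "inv u x < inv u (transpose p q y) \<longleftrightarrow> inv u x < inv u y" if "x \<noteq> p" "x \<noteq> q" for x y
    using that adj ne[of x] by (auto simp: transpose_def)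
  moreover have "inv u (transpose p q y) < inv u x \<longleftrightarrow> inv u y < inv u x" if "x \<noteq> p" "x \<noteq> q" for x y
    using that adj ne[of x] by (auto simp: transpose_def)
  ultimately have "(x, y) \<in> vinv n (transpose p q \<circ> u) \<longleftrightarrow> (x, y) \<in> insert (p, q) (vinv n u)" for x y
    unfolding vinv_iff inv_transpose_comp[OF u] insert_iff prod.inject
    using pq adj
    by (cases "x = p \<or> x = q"; cases "y = p \<or> y = q")
      (auto simp: transpose_def split: if_splits)
  then show "vinv n (transpose p q \<circ> u) = insert (p, q) (vinv n u)" by auto
qed

lemma vinv_swap_down:
  assumes u: "u permutes {1..n}" and adj: "inv u p = Suc (inv u q)"
    and pq: "1 \<le> p" "p < q" "q \<le> n"
  shows "transpose p q \<circ> u permutes {1..n}"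
    and "vinv n (transpose p q \<circ> u) = vinv n u - {(p, q)}" "(p, q) \<in> vinv n u"
proof -
  show perm: "transpose p q \<circ> u permutes {1..n}"
    using pq by (intro permutes_compose[OF u] permutes_swap_id) auto
  show "(p, q) \<in> vinv n u" using adj pq by (auto simp: vinv_iff)
  have "inv (transpose p q \<circ> u) q = Suc (inv (transpose p q \<circ> u) p)"
    using adj pq by (simp add: inv_transpose_comp[OF u])
  note * = vinv_swap_up[OF perm this pq]
  have "transpose p q \<circ> (transpose p q \<circ> u) = u" by (auto simp: fun_eq_iff)
  with * show "vinv n (transpose p q \<circ> u) = vinv n u - {(p, q)}" by auto
qed

text \<open>Take a pair of \<open>y\<close> missing in \<open>x\<close> whose values stand closest
  together in \<open>x\<close>. If they were not adjacent, the value right after \<open>p\<close>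
  would form a closer missing pair with \<open>p\<close> or \<open>q\<close>.\<close>

lemma exists_adjacent_ascent:
  assumes x: "x permutes {1..n}" and sub: "vinv n x \<subseteq> vinv n y"
    and ne: "vinv n x \<noteq> vinv n y"
  obtains p q where "(p, q) \<in> vinv n y" "(p, q) \<notin> vinv n x" "inv x q = Suc (inv x p)"
proof -
  let ?D = "\<lambda>(p, q). (p, q) \<in> vinv n y \<and> (p, q) \<notin> vinv n x"
  define m where "m = (\<lambda>(p, q). inv x q - inv x p)"
  obtain z0 where "?D z0" using sub ne by auto
  then obtain z where z: "?D z" and min: "\<And>z'. ?D z' \<Longrightarrow> m z \<le> m z'"
    using ex_has_least_nat[of ?D z0 m] by blast
  obtain p q where z_eq: "z = (p, q)" by (cases z)
  have D: "(p, q) \<in> vinv n y" "(p, q) \<notin> vinv n x" using z z_eq by auto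
  then have lt: "inv x p < inv x q"
    using pos_eq_iff[OF x, of p q] by (auto simp: vinv_iff)
  have no: False if h: "(c, d) \<in> vinv n y" "(c, d) \<notin> vinv n x"
      "inv x c < inv x d" "inv x p + inv x d < inv x q + inv x c" for c d
    using min[of "(c, d)"] h z_eq by (auto simp: m_def)
  have "inv x q = Suc (inv x p)"
  proof (rule ccontr)
    assume "inv x q \<noteq> Suc (inv x p)"
    define e where "e = x (Suc (inv x p))"
    have pe: "inv x e = Suc (inv x p)" unfolding e_def using x by (simp add: permutes_inverses)
    then have e: "inv x p < inv x e" "inv x e < inv x q"
      using lt \<open>inv x q \<noteq> _\<close> by auto
    have "inv x p \<in> {1..n}" "inv x q \<in> {1..n}" using D pos_in_iff[OF x] by (auto simp: vinv_iff)
    then have en: "e \<in> {1..n}" using pos_in_iff[OF x, of e] e by auto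
    have "p \<noteq> e" "e \<noteq> q" using e by auto
    \<comment> \<open>If \<open>e\<close> lies outside the range from \<open>p\<close> to
      \<open>q\<close>, it is inverted in \<open>x\<close> with \<open>p\<close> or
      \<open>q\<close>, and transitivity in \<open>y\<close> gives the closer pair; inside the
      range, the pair \<open>(p, q)\<close> itself splits in \<open>y\<close>.\<close>
    then consider "e < p" | "p < e" "e < q" | "q < e" by linarith
    then show False
    proof cases
      case 1
      then have "(e, p) \<in> vinv n x" using D e en by (auto simp: vinv_iff)
      then have "(e, q) \<in> vinv n y" using sub D vinv_trans by blast
      moreover have "(e, q) \<notin> vinv n x" using e by (auto simp: vinv_iff)
      ultimately show False using no[of e q] e by auto
    next
      case 2
      have "(p, e) \<notin> vinv n x" "(e, q) \<notin> vinv n x" using e by (auto simp: vinv_iff)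
      then show False using vinv_coclosed[OF D(1) 2] no[of p e] no[of e q] e by auto
    next
      case 3
      then have "(q, e) \<in> vinv n x" using D e en by (auto simp: vinv_iff)
      then have "(p, e) \<in> vinv n y" using sub D vinv_trans by blast
      moreover have "(p, e) \<notin> vinv n x" using e by (auto simp: vinv_iff)
      ultimately show False using no[of p e] e by auto
    qed
  qed
  then show ?thesis using that D by blast
qed

section \<open>Arcs\<close>

definition desc :: "nat \<Rightarrow> (nat \<Rightarrow> nat) \<Rightarrow> (nat \<times> nat) set" where
  "desc n u = {(p, q). (p, q) \<in> vinv n u \<and> inv u p = Suc (inv u q)}"

text \<open>Membership in \<open>vinv n w\<close> contains \<open>p < q\<close> and keeps only the
  ascents whose exchange stays below \<open>w\<close>.\<close>

definition asc :: "nat \<Rightarrow> (nat \<Rightarrow> nat) \<Rightarrow> (nat \<Rightarrow> nat) \<Rightarrow> (nat \<times> nat) set" where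
  "asc n w u = {(p, q). (p, q) \<in> vinv n w \<and> inv u q = Suc (inv u p)}"

definition arc :: "(nat \<Rightarrow> nat) \<Rightarrow> nat \<times> nat \<Rightarrow> nat \<times> nat \<times> nat set" where
  "arc u = (\<lambda>(p, q). (p, q, {c. p < c \<and> c < q \<and> inv u c < inv u p}))"

text \<open>The inversion set of a join-irreducible element: in its word the values from
  \<open>p\<close> to \<open>q\<close> appear as \<open>A\<close> and \<open>q\<close> in increasing
  order, followed by \<open>p\<close> and the remaining ones in increasing order.\<close>

definition arc_inv :: "nat \<times> nat \<times> nat set \<Rightarrow> (nat \<times> nat) set" where
  "arc_inv = (\<lambda>(p, q, A). {(x, y). p \<le> x \<and> x < y \<and> y \<le> q \<and> x \<notin> A \<and> (y = q \<or> y \<in> A)})"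

definition arc_perm :: "nat \<Rightarrow> nat \<times> nat \<times> nat set \<Rightarrow> nat \<Rightarrow> nat" where
  "arc_perm n \<alpha> = (THE u. u permutes {1..n} \<and> vinv n u = arc_inv \<alpha>)"

definition arcs :: "nat \<Rightarrow> (nat \<times> nat \<times> nat set) set" where
  "arcs n = {(p, q, A). 1 \<le> p \<and> p < q \<and> q \<le> n \<and> A \<subseteq> {p<..<q}}"

lemma arc_in_arcs: "1 \<le> p \<Longrightarrow> p < q \<Longrightarrow> q \<le> n \<Longrightarrow> arc u (p, q) \<in> arcs n"
  by (auto simp: arc_def arcs_def)

lemma arc_perm_props:
  assumes "\<alpha> \<in> arcs n"
  shows "arc_perm n \<alpha> permutes {1..n}" "vinv n (arc_perm n \<alpha>) = arc_inv \<alpha>"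
proof -
  obtain p q A where \<alpha>: "\<alpha> = (p, q, A)" "1 \<le> p" "p < q" "q \<le> n" "A \<subseteq> {p<..<q}"
    using assms by (auto simp: arcs_def)
  have "\<exists>u. u permutes {1..n} \<and> vinv n u = arc_inv \<alpha>"
    using \<alpha> by (intro vinv_exists) (auto simp: arc_inv_def trans_def)
  then have "\<exists>!u. u permutes {1..n} \<and> vinv n u = arc_inv \<alpha>"
    using vinv_inject by metis
  from theI'[OF this] show "arc_perm n \<alpha> permutes {1..n}" "vinv n (arc_perm n \<alpha>) = arc_inv \<alpha>"
    by (simp_all add: arc_perm_def)
qed

text \<open>The ends \<open>p\<close> and \<open>q\<close> are the least and the greatest value that
  occur, and the pairs \<open>(p, y)\<close> reveal \<open>A\<close>.\<close>

lemma arc_inv_inject: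
  assumes "\<alpha> \<in> arcs n" "\<beta> \<in> arcs n" "arc_inv \<alpha> = arc_inv \<beta>"
  shows "\<alpha> = \<beta>"
proof -
  obtain p q A where \<alpha>: "\<alpha> = (p, q, A)" "p < q" "A \<subseteq> {p<..<q}"
    using assms by (auto simp: arcs_def)
  obtain p' q' A' where \<beta>: "\<beta> = (p', q', A')" "p' < q'" "A' \<subseteq> {p'<..<q'}"
    using assms by (auto simp: arcs_def)
  have eq: "(x, y) \<in> arc_inv (p, q, A) \<longleftrightarrow> (x, y) \<in> arc_inv (p', q', A')" for x y
    using assms(3) \<alpha> \<beta> by simp
  have "(p, q) \<in> arc_inv (p, q, A)" "(p', q') \<in> arc_inv (p', q', A')"
    using \<alpha> \<beta> by (auto simp: arc_inv_def)
  then have "(p, q) \<in> arc_inv (p', q', A')" "(p', q') \<in> arc_inv (p, q, A)" using eq by blast+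
  then have pq: "p = p'" "q = q'" by (auto simp: arc_inv_def)
  have "y \<in> A \<longleftrightarrow> (p, y) \<in> arc_inv (p, q, A)" if "y \<in> {p<..<q}" for y
    using that \<alpha> by (auto simp: arc_inv_def)
  moreover have "y \<in> A' \<longleftrightarrow> (p, y) \<in> arc_inv (p', q', A')" if "y \<in> {p<..<q}" for y
    using that \<beta> pq by (auto simp: arc_inv_def)
  ultimately have "A = A'" using eq \<alpha>(3) \<beta>(3) pq by blast
  then show ?thesis using \<alpha> \<beta> pq by simp
qed

lemma inj_arc_perm: "inj_on (arc_perm n) (arcs n)"
  by (metis arc_inv_inject arc_perm_props(2) inj_onI)

section \<open>Transitive closures, the source of joins\<close>

text \<open>A path from \<open>p\<close> to \<open>r\<close> either visits \<open>q\<close> or has a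
  step that jumps over \<open>q\<close>, and the assumption on \<open>G\<close> splits that step at
  \<open>q\<close>.\<close>

lemma trancl_coclosed:
  fixes G :: "('a :: linorder \<times> 'a) set"
  assumes co: "\<And>p q r. (p, r) \<in> G \<Longrightarrow> p < q \<Longrightarrow> q < r \<Longrightarrow> (p, q) \<in> G \<or> (q, r) \<in> G"
    and "(p, r) \<in> G\<^sup>+" "p < q" "q < r"
  shows "(p, q) \<in> G\<^sup>+ \<or> (q, r) \<in> G\<^sup>+"
  using assms(2-)
proof (induction rule: trancl_induct)
  case (base r)
  then show ?case using co[of p r q] by blast
next
  case (step r s)
  consider "q < r" | "q = r" | "r < q" using linorder_less_linear by blast
  then show ?case
  proof cases
    case 1
    with step.IH step.prems have "(p, q) \<in> G\<^sup>+ \<or> (q, r) \<in> G\<^sup>+" by blast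
    then show ?thesis using step.hyps(2) by (meson trancl.trancl_into_trancl)
  next
    case 2
    then show ?thesis using step.hyps(1) by blast
  next
    case 3
    then have "(r, q) \<in> G \<or> (q, s) \<in> G"
      using step.hyps(2) step.prems co[of r s q] by blast
    then show ?thesis using step.hyps(1) by (meson trancl.trancl_into_trancl r_into_trancl)
  qed
qed

lemma trancl_vinv_exists:
  assumes sub: "\<And>p q. (p, q) \<in> G \<Longrightarrow> 1 \<le> p \<and> p < q \<and> q \<le> n"
    and co: "\<And>p q r. (p, r) \<in> G \<Longrightarrow> p < q \<Longrightarrow> q < r \<Longrightarrow> (p, q) \<in> G \<or> (q, r) \<in> G"
  shows "\<exists>u. u permutes {1..n} \<and> vinv n u = G\<^sup>+"
proof (rule vinv_exists)
  show "1 \<le> p \<and> p < q \<and> q \<le> n" if "(p, q) \<in> G\<^sup>+" for p q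
    using that by induction (use sub in force)+
qed (use trancl_coclosed[of G] co in auto)

lemma arc_inv_coclosed:
  assumes "(p, r) \<in> arc_inv \<alpha>" "p < q" "q < r"
  shows "(p, q) \<in> arc_inv \<alpha> \<or> (q, r) \<in> arc_inv \<alpha>"
  using assms by (auto simp: arc_inv_def)

text \<open>In a pair of \<open>arc_inv\<close> the larger value stands at \<open>q\<close> or
  further left in \<open>u\<close>, the smaller one at \<open>p\<close> or further right.\<close>

lemma arc_inv_desc:
  assumes u: "u permutes {1..n}" and d: "(p, q) \<in> desc n u"
  shows "arc_inv (arc u (p, q)) \<subseteq> vinv n u"
proof
  fix e assume "e \<in> arc_inv (arc u (p, q))"
  then obtain c d where e: "e = (c, d)" "p \<le> c" "c < d" "d \<le> q"
    "\<not> (p < c \<and> inv u c < inv u p)" "d = q \<or> inv u d < inv u p"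
    by (auto simp: arc_inv_def arc_def)
  have adj: "inv u p = Suc (inv u q)" "1 \<le> p" "q \<le> n" using d by (auto simp: desc_def vinv_iff)
  have "d = q \<or> inv u d < inv u q" using e(6) adj pos_eq_iff[OF u, of d q] by auto
  moreover have "inv u p \<le> inv u c" using e by (cases "c = p") auto
  ultimately show "e \<in> vinv n u" using e adj by (auto simp: vinv_iff)
qed

section \<open>Covers, joins and labels in an initial interval of weak order\<close>

text \<open>Serves to find neighbouring positions at which a word passes a threshold value.\<close>

lemma exists_last_before:
  fixes a b :: nat
  assumes "P a" "\<not> P b" "a < b"
  obtains k where "a \<le> k" "k < b" "P k" "\<not> P (Suc k)"
proof -
  have "\<exists>k\<ge>a. k < b \<and> P k \<and> \<not> P (Suc k)"
    using assms(3,2)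
  proof (induction b)
    case (Suc b)
    show ?case
    proof (cases "P b")
      case True
      then show ?thesis using Suc.prems by (intro exI[of _ b]) auto
    next
      case False
      then have "a < b" using Suc.prems assms(1) by (cases "a = b") auto
      then obtain k where "a \<le> k" "k < b" "P k" "\<not> P (Suc k)" using Suc.IH False by blast
      then show ?thesis by (intro exI[of _ k]) auto
    qed
  qed simp
  then show ?thesis using that by blast
qed

lemma rtrancl_crossing:
  fixes G :: "('a :: linorder \<times> 'a) set"
  assumes "(x, y) \<in> G\<^sup>*" "x \<le> q" "q \<le> y"
  shows "((x, q) \<in> G\<^sup>* \<and> (q, y) \<in> G\<^sup>*) \<or>
    (\<exists>i j. (x, i) \<in> G\<^sup>* \<and> (i, j) \<in> G \<and> (j, y) \<in> G\<^sup>* \<and> i < q \<and> q < j)"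
  using assms
proof (induction rule: rtrancl_induct)
  case (step y z)
  consider "q \<le> y" | "q = z" | "y < q" "q < z" using step.prems by fastforce
  then show ?case
  proof cases
    case 1
    from step.IH[OF step.prems(1) 1] show ?thesis
      using rtrancl.rtrancl_into_rtrancl[OF _ step.hyps(2)] by metis
  next
    case 2
    then show ?thesis using step.hyps by auto
  next
    case 3
    then have "(x, y) \<in> G\<^sup>* \<and> (y, z) \<in> G \<and> (z, z) \<in> G\<^sup>* \<and> y < q \<and> q < z"
      using step.hyps by simp
    then show ?thesis by blast
  qed
qed auto

locale weak_initial_interval =
  fixes n :: nat and w :: "nat \<Rightarrow> nat"
  assumes w: "w permutes {1..n}"
begin

abbreviation L where "L \<equiv> weak_interval n w"

lemma carrier_iff: "u \<in> carrier L \<longleftrightarrow> u permutes {1..n} \<and> vinv n u \<subseteq> vinv n w"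
  by (auto simp: weak_interval_def weak_le_def vinv_def Inv_def)

lemma le_iff: "le L x y \<longleftrightarrow> vinv n x \<subseteq> vinv n y"
  by (simp add: weak_interval_def weak_le_def vinv_def)

lemma eq_iff: "eq L x y \<longleftrightarrow> x = y"
  by (simp add: weak_interval_def)

lemma vinv_eq_iff: "x \<in> carrier L \<Longrightarrow> y \<in> carrier L \<Longrightarrow> vinv n x = vinv n y \<longleftrightarrow> x = y"
  using vinv_inject by (auto simp: carrier_iff)

lemma less_iff: "x \<in> carrier L \<Longrightarrow> y \<in> carrier L \<Longrightarrow> lless L x y \<longleftrightarrow> vinv n x \<subset> vinv n y"
  using vinv_eq_iff by (auto simp: lless_def le_iff eq_iff)

lemma finite_carrier: "finite (carrier L)"
  by (rule finite_subset[OF _ finite_permutations[of "{1..n}"]]) (auto simp: carrier_iff)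

text \<open>An adjacent ascent of \<open>x\<close> that is inverted in \<open>y\<close> yields an
  element above \<open>x\<close> and weakly below \<open>y\<close>, which a cover forces to be
  \<open>y\<close>. Conversely, sets that differ by one pair leave no room in between.\<close>

lemma covered_by_iff:
  "covered_by L x y \<longleftrightarrow> x \<in> carrier L \<and> y \<in> carrier L \<and>
     (\<exists>p q. 1 \<le> p \<and> p < q \<and> q \<le> n \<and> inv x q = Suc (inv x p) \<and> y = transpose p q \<circ> x)"
    (is "_ \<longleftrightarrow> ?R")
proof
  assume cov: "covered_by L x y"
  then have xy: "x \<in> carrier L" "y \<in> carrier L" by (auto simp: covered_by_def)
  then have x: "x permutes {1..n}" and y: "y permutes {1..n}" by (auto simp: carrier_iff)
  have less: "vinv n x \<subset> vinv n y" using cov less_iff[OF xy] by (simp add: covered_by_def)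
  then obtain p q where pq: "(p, q) \<in> vinv n y" "(p, q) \<notin> vinv n x" "inv x q = Suc (inv x p)"
    using exists_adjacent_ascent[OF x, of y] by blast
  then have r: "1 \<le> p" "p < q" "q \<le> n" by (auto simp: vinv_iff)
  let ?z = "transpose p q \<circ> x"
  note z = vinv_swap_up[OF x pq(3) r]
  have zc: "?z \<in> carrier L"
    using z less pq xy by (auto simp: carrier_iff)
  have "vinv n x \<subset> vinv n ?z" using z by auto
  then have "\<not> vinv n ?z \<subset> vinv n y"
    using cov zc xy by (auto simp: covered_by_def less_iff)
  then have "vinv n ?z = vinv n y" using z less pq by auto
  then have "y = ?z" using vinv_eq_iff zc xy by blast
  then show ?R using xy r pq by blast
next
  assume R: ?R
  then obtain p q where pq: "1 \<le> p" "p < q" "q \<le> n" "inv x q = Suc (inv x p)" and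
    y: "y = transpose p q \<circ> x" by blast
  have xy: "x \<in> carrier L" "y \<in> carrier L" using R by auto
  have "x permutes {1..n}" using xy by (auto simp: carrier_iff)
  from vinv_swap_up[OF this pq(4,1-3)]
  have *: "vinv n y = insert (p, q) (vinv n x)" "(p, q) \<notin> vinv n x" by (auto simp: y)
  then have "\<not> (vinv n x \<subset> vinv n z \<and> vinv n z \<subset> vinv n y)" for z by auto
  then show "covered_by L x y"
    using * xy unfolding covered_by_def by (auto simp: less_iff)
qed

lemma covered_by_desc:
  assumes u: "u \<in> carrier L"
  shows "covered_by L x u \<longleftrightarrow> (\<exists>(p, q) \<in> desc n u. x = transpose p q \<circ> u)"
proof
  assume "covered_by L x u"
  then obtain p q where pq: "1 \<le> p" "p < q" "q \<le> n" "inv x q = Suc (inv x p)" and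
    y: "u = transpose p q \<circ> x" and x: "x permutes {1..n}" by (auto simp: covered_by_iff carrier_iff)
  have "(p, q) \<in> desc n u"
    using pq vinv_swap_up(2)[OF x pq(4,1-3)] by (auto simp: y desc_def inv_transpose_comp[OF x])
  moreover have "x = transpose p q \<circ> u" by (auto simp: y fun_eq_iff)
  ultimately show "\<exists>(p, q) \<in> desc n u. x = transpose p q \<circ> u" by blast
next
  assume "\<exists>(p, q) \<in> desc n u. x = transpose p q \<circ> u"
  then obtain p q where pq: "1 \<le> p" "p < q" "q \<le> n" "inv u p = Suc (inv u q)" and
    x: "x = transpose p q \<circ> u" by (auto simp: desc_def vinv_iff)
  have up: "u permutes {1..n}" using u by (simp add: carrier_iff)
  note s = vinv_swap_down[OF up pq(4,1-3)]
  have "x \<in> carrier L" using s u by (auto simp: x carrier_iff)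
  moreover have "u = transpose p q \<circ> x" by (auto simp: x fun_eq_iff)
  moreover have "inv x q = Suc (inv x p)" using pq by (simp add: x inv_transpose_comp[OF up])
  ultimately show "covered_by L x u" using u pq by (auto simp: covered_by_iff)
qed

lemma covers_asc:
  assumes u: "u \<in> carrier L"
  shows "covered_by L u y \<longleftrightarrow> (\<exists>(p, q) \<in> asc n w u. y = transpose p q \<circ> u)"
proof -
  have up: "u permutes {1..n}" "vinv n u \<subseteq> vinv n w" using u by (auto simp: carrier_iff)
  have "transpose p q \<circ> u \<in> carrier L \<longleftrightarrow> (p, q) \<in> vinv n w"
    if "1 \<le> p" "p < q" "q \<le> n" "inv u q = Suc (inv u p)" for p q
    using vinv_swap_up[OF up(1) that(4,1-3)] up(2) by (auto simp: carrier_iff)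
  then show ?thesis
    using u unfolding covered_by_iff asc_def by (fastforce simp: vinv_iff)
qed

lemma ddeg_eq: assumes u: "u \<in> carrier L" shows "ddeg L u = card (desc n u)"
proof -
  have up: "u permutes {1..n}" using u by (simp add: carrier_iff)
  let ?f = "\<lambda>(p, q). transpose p q \<circ> u"
  have v: "vinv n (?f z) = vinv n u - {z}" "z \<in> vinv n u" if "z \<in> desc n u" for z
    using that vinv_swap_down[OF up, of "fst z" "snd z"] by (auto simp: desc_def vinv_iff)
  have "{x. covered_by L x u} = ?f ` desc n u"
    using covered_by_desc[OF u] by fastforce
  moreover have "inj_on ?f (desc n u)"
  proof (rule inj_onI)
    fix z z' assume "z \<in> desc n u" "z' \<in> desc n u" "?f z = ?f z'"
    with v[of z] v[of z'] show "z = z'" by (metis Diff_iff insertI1 insertE empty_iff insertCI)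
  qed
  ultimately show ?thesis by (simp add: ddeg_def card_image)
qed

section \<open>Joins and labels of covers\<close>

text \<open>The closure of the union is an inversion set by \<open>trancl_vinv_exists\<close>, and
  any inversion set containing both sets contains it by transitivity.\<close>

lemma join_props:
  assumes x: "x \<in> carrier L" and z: "z \<in> carrier L"
  shows "join L x z \<in> carrier L" "vinv n (join L x z) = (vinv n x \<union> vinv n z)\<^sup>+"
proof -
  have "\<exists>v. v permutes {1..n} \<and> vinv n v = (vinv n x \<union> vinv n z)\<^sup>+"
  proof (rule trancl_vinv_exists)
    show "1 \<le> p \<and> p < q \<and> q \<le> n" if "(p, q) \<in> vinv n x \<union> vinv n z" for p q
      using that by (auto simp: vinv_iff)
    show "(p, q) \<in> vinv n x \<union> vinv n z \<or> (q, r) \<in> vinv n x \<union> vinv n z"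
      if "(p, r) \<in> vinv n x \<union> vinv n z" "p < q" "q < r" for p q r
      using that vinv_coclosed by blast
  qed
  then obtain v where v: "v permutes {1..n}" "vinv n v = (vinv n x \<union> vinv n z)\<^sup>+"
    by blast
  have sub: "vinv n v \<subseteq> vinv n y" if "vinv n x \<subseteq> vinv n y" "vinv n z \<subseteq> vinv n y" for y
    unfolding v(2) using that trancl_mono_subset[of "vinv n x \<union> vinv n z" "vinv n y"]
      trancl_id[OF trans_vinv] by auto
  then have vc: "v \<in> carrier L" using v x z by (auto simp: carrier_iff)
  have U: "Upper L {x, z} = {y \<in> carrier L. vinv n x \<subseteq> vinv n y \<and> vinv n z \<subseteq> vinv n y}"
    using x z by (auto simp: Upper_def le_iff)
  have "vinv n x \<subseteq> vinv n v \<and> vinv n z \<subseteq> vinv n v" by (auto simp: v)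
  then have least: "least L v (Upper L {x, z})"
    using vc sub by (auto simp: least_def U le_iff)
  moreover have "y = v" if "least L y (Upper L {x, z})" for y
  proof -
    have "vinv n y = vinv n v" "y \<in> carrier L"
      using that least by (auto simp: least_def le_iff U)
    then show ?thesis using vinv_eq_iff vc by blast
  qed
  ultimately have "join L x z = v" unfolding join_def sup_def by (rule some_equality)
  then show "join L x z \<in> carrier L" "vinv n (join L x z) = (vinv n x \<union> vinv n z)\<^sup>+"
    using v vc by auto
qed

text \<open>The arc element lies below \<open>y\<close> and supplies the missing pair
  \<open>(p, q)\<close>. Conversely, any \<open>z\<close> whose join with \<open>x\<close> is
  \<open>y\<close> contains \<open>(p, q)\<close>, and splitting this pair at the values in between
  forces all of \<open>arc_inv\<close> into \<open>z\<close>.\<close>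

lemma gamma_eq:
  assumes x: "x \<in> carrier L" and y: "y \<in> carrier L" and pq: "1 \<le> p" "p < q" "q \<le> n"
    and adj: "inv x q = Suc (inv x p)" and y_eq: "y = transpose p q \<circ> x"
  shows "gamma L x y = arc_perm n (arc y (p, q))"
proof -
  have xp: "x permutes {1..n}" and yp: "y permutes {1..n}" using x y by (auto simp: carrier_iff)
  let ?j = "arc_perm n (arc y (p, q))"
  define A where "A = {c. p < c \<and> c < q \<and> inv y c < inv y p}"
  note sw = vinv_swap_up(2,3)[OF xp adj pq, folded y_eq]
  have adjy: "inv y p = Suc (inv y q)" using adj by (simp add: y_eq inv_transpose_comp[OF xp])
  have A: "c \<in> A \<longleftrightarrow> inv y c < inv y q" "c \<notin> A \<longleftrightarrow> inv y p < inv y c" if "p < c" "c < q" for c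
    using that pos_eq_iff[OF yp, of c p] pos_eq_iff[OF yp, of c q] adjy by (auto simp: A_def)
  have arc: "arc y (p, q) = (p, q, A)" by (simp add: arc_def A_def)
  have j: "?j permutes {1..n}" "vinv n ?j = arc_inv (p, q, A)"
    using arc_perm_props[OF arc_in_arcs[OF pq, of y]] unfolding arc by auto
  have "(p, q) \<in> desc n y" using adjy pq by (auto simp: desc_def vinv_iff)
  then have jy: "vinv n ?j \<subseteq> vinv n y" using arc_inv_desc[OF yp, of p q] unfolding j(2) by (simp add: arc)
  have jc: "?j \<in> carrier L" using j jy y by (auto simp: carrier_iff)
  have "(p, q) \<in> vinv n ?j" using pq by (auto simp: j arc_inv_def A_def)
  then have "vinv n x \<union> vinv n ?j = vinv n y" using sw jy by auto
  then have "join L x ?j = y"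
    using join_props[OF x jc] vinv_eq_iff y trancl_id[OF trans_vinv] by metis
  moreover have "vinv n ?j \<subseteq> vinv n z" if z: "z \<in> carrier L" "join L x z = y" for z
  proof -
    have zy: "vinv n z \<subseteq> vinv n y" using join_props[OF x z(1)] z(2) by auto
    have "(p, q) \<in> vinv n z"
    proof (rule ccontr)
      assume "(p, q) \<notin> vinv n z"
      then have "vinv n x \<union> vinv n z = vinv n x" using zy sw by auto
      then show False using join_props(2)[OF x z(1)] z(2) sw trancl_id[OF trans_vinv, of n x] by auto
    qed
    \<comment> \<open>Splitting \<open>(p, q)\<close> at \<open>c\<close> leaves two options in
      \<open>z\<close>, and the position of \<open>c\<close> in \<open>y\<close> rules out one of
      them.\<close>
    then have 1: "(p, c) \<in> vinv n z" if "p < c" "c < q" "c \<in> A" for c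
    proof -
      have "(c, q) \<notin> vinv n y" using A(1)[OF that(1,2)] that by (auto simp: vinv_iff)
      then show ?thesis using vinv_coclosed[OF \<open>(p, q) \<in> vinv n z\<close> that(1,2)] zy by blast
    qed
    have 2: "(c, q) \<in> vinv n z" if "p < c" "c < q" "c \<notin> A" for c
    proof -
      have "(p, c) \<notin> vinv n y" using A(2)[OF that(1,2)] that by (auto simp: vinv_iff)
      then show ?thesis using vinv_coclosed[OF \<open>(p, q) \<in> vinv n z\<close> that(1,2)] zy by blast
    qed
    show ?thesis
    proof
      fix e assume "e \<in> vinv n ?j"
      then obtain c d where e: "e = (c, d)" "p \<le> c" "c < d" "d \<le> q" "c \<notin> A" "d = q \<or> d \<in> A"
        by (auto simp: j arc_inv_def)
      have pd: "(p, d) \<in> vinv n z" using e 1[of d] \<open>(p, q) \<in> vinv n z\<close> by (cases "d = q") auto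
      show "e \<in> vinv n z"
      proof (cases "c = p")
        case False
        then have c: "p < c" "c < q" using e by auto
        then have "(p, c) \<notin> vinv n y" using A(2)[OF c] e by (auto simp: vinv_iff)
        then have "(p, c) \<notin> vinv n z" using zy by blast
        then show ?thesis using vinv_coclosed[OF pd, of c] c e by auto
      qed (use pd e in simp)
    qed
  qed
  ultimately have "least L ?j {z \<in> carrier L. join L x z = y}"
    using jc by (auto simp: least_def le_iff)
  moreover have "z = ?j" if "least L z {z \<in> carrier L. join L x z = y}" for z
    using that calculation vinv_eq_iff[of z ?j] by (auto simp: least_def le_iff)
  ultimately show ?thesis unfolding gamma_def by (rule the_equality)
qed

section \<open>Arcs of descents and of allowed ascents\<close>

definition down_arcs :: "(nat \<Rightarrow> nat) \<Rightarrow> (nat \<times> nat \<times> nat set) set" where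
  "down_arcs u = arc u ` desc n u"

definition up_arcs :: "(nat \<Rightarrow> nat) \<Rightarrow> (nat \<times> nat \<times> nat set) set" where
  "up_arcs u = arc u ` asc n w u"

lemma down_arcs_subset: "down_arcs u \<subseteq> arcs n"
  by (auto simp: down_arcs_def desc_def vinv_iff intro!: arc_in_arcs)

lemma up_arcs_subset: "up_arcs u \<subseteq> arcs n"
  by (auto simp: up_arcs_def asc_def vinv_iff intro!: arc_in_arcs)

lemma down_labels_eq:
  assumes y: "y \<in> carrier L"
  shows "down_labels L y = arc_perm n ` down_arcs y"
proof -
  have yp: "y permutes {1..n}" using y by (simp add: carrier_iff)
  have "gamma L (transpose p q \<circ> y) y = arc_perm n (arc y (p, q))" if d: "(p, q) \<in> desc n y" for p q
  proof -
    have "covered_by L (transpose p q \<circ> y) y" using covered_by_desc[OF y] d by blast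
    then have "transpose p q \<circ> y \<in> carrier L" by (simp add: covered_by_def)
    then show ?thesis
      using d by (intro gamma_eq)
        (auto simp: y desc_def vinv_iff inv_transpose_comp[OF yp] fun_eq_iff)
  qed
  then show ?thesis
    unfolding down_labels_def down_arcs_def covered_by_desc[OF y] by (force simp: image_iff)
qed

text \<open>The exchange does not move the values left of the pair, so the label of an upper cover
  can be read off in the lower element.\<close>

lemma arc_swap:
  assumes u: "u permutes {1..n}" and "(p, q) \<in> asc n w u"
  shows "arc (transpose p q \<circ> u) (p, q) = arc u (p, q)"
proof -
  have adj: "inv u q = Suc (inv u p)" using assms(2) by (simp add: asc_def)
  have "inv u c < inv u q \<longleftrightarrow> inv u c < inv u p" if "p < c" for c
    using adj pos_eq_iff[OF u, of c p] that by auto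
  then show ?thesis
    by (auto simp: arc_def inv_transpose_comp[OF u] transpose_def)
qed

lemma up_labels_eq:
  assumes y: "y \<in> carrier L"
  shows "up_labels L y = arc_perm n ` up_arcs y"
proof -
  have yp: "y permutes {1..n}" using y by (simp add: carrier_iff)
  have "gamma L y (transpose p q \<circ> y) = arc_perm n (arc y (p, q))" if d: "(p, q) \<in> asc n w y" for p q
  proof -
    have "covered_by L y (transpose p q \<circ> y)" using covers_asc[OF y] d by blast
    then have "transpose p q \<circ> y \<in> carrier L" by (simp add: covered_by_def)
    then have "gamma L y (transpose p q \<circ> y) = arc_perm n (arc (transpose p q \<circ> y) (p, q))"
      using d by (intro gamma_eq) (auto simp: y asc_def vinv_iff)
    then show ?thesis using arc_swap[OF yp d] by simp
  qed
  then show ?thesis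
    unfolding up_labels_def up_arcs_def covers_asc[OF y] by (force simp: image_iff)
qed

text \<open>As \<open>arc_perm\<close> is injective on arcs, the equation that defines rowmotion
  becomes one between sets of arcs.\<close>

lemma labels_eq_iff:
  assumes "x \<in> carrier L" "y \<in> carrier L"
  shows "down_labels L x = up_labels L y \<longleftrightarrow> down_arcs x = up_arcs y"
  using assms inj_on_image_eq_iff[OF inj_arc_perm down_arcs_subset up_arcs_subset]
  by (simp add: down_labels_eq up_labels_eq)

subsection \<open>Rowmotion on arcs\<close>

text \<open>Every element is the join of its labels. By induction on the distance in
  \<open>x\<close>, an inversion either splits at an intermediate value or belongs to
  \<open>arc_inv\<close> of a single descent.\<close>

lemma vinv_le_if_down_arcs:
  assumes x: "x \<in> carrier L" and sub: "\<And>\<alpha>. \<alpha> \<in> down_arcs x \<Longrightarrow> arc_inv \<alpha> \<subseteq> vinv n v"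
  shows "vinv n x \<subseteq> vinv n v"
proof -
  have xp: "x permutes {1..n}" using x by (simp add: carrier_iff)
  have "(c, d) \<in> vinv n x \<Longrightarrow> (c, d) \<in> vinv n v" for c d
  proof (induction "inv x c - inv x d" arbitrary: c d rule: less_induct)
    case less
    from less.prems have cd: "1 \<le> c" "c < d" "d \<le> n" "inv x d < inv x c" by (auto simp: vinv_iff)
    show ?case
    proof (cases "\<exists>e. c < e \<and> e < d \<and> inv x d < inv x e \<and> inv x e < inv x c")
      case True
      then obtain e where e: "c < e" "e < d" "inv x d < inv x e" "inv x e < inv x c" by blast
      then have "(c, e) \<in> vinv n x" "(e, d) \<in> vinv n x" using cd by (auto simp: vinv_iff)
      moreover have "inv x c - inv x e < inv x c - inv x d" "inv x e - inv x d < inv x c - inv x d"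
        using e by linarith+
      ultimately have "(c, e) \<in> vinv n v" "(e, d) \<in> vinv n v" using less.hyps by blast+
      then show ?thesis by (rule vinv_trans)
    next
      case False
      \<comment> \<open>The stretch begins with \<open>d\<close> and ends with \<open>c\<close>, so
        somewhere it falls from a value \<open>\<ge> d\<close> to one below \<open>d\<close>. The
        latter is at most \<open>c\<close>, as no value strictly between \<open>c\<close> and
        \<open>d\<close> stands here.\<close>
      have "d \<le> x (inv x d)" "\<not> d \<le> x (inv x c)" using cd xp by (auto simp: permutes_inverses)
      then obtain k where k: "inv x d \<le> k" "k < inv x c" "d \<le> x k" "\<not> d \<le> x (Suc k)"
        using exists_last_before[where P = "\<lambda>k. d \<le> x k"] cd(4) by blast
      define c' d' where "c' = x (Suc k)" and "d' = x k"
      have pos: "inv x c' = Suc k" "inv x d' = k"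
        using xp by (auto simp: c'_def d'_def permutes_inverses)
      have "c' \<le> c"
      proof (cases "Suc k = inv x c")
        case True
        then have "inv x c' = inv x c" using pos(1) by (rule trans[rotated])
        then show ?thesis using pos_eq_iff[OF xp, of c' c] by (metis order_refl)
      next
        case ne: False
        have "\<not> (c < c' \<and> c' < d \<and> inv x d < inv x c' \<and> inv x c' < inv x c)" using False by blast
        then show ?thesis using ne k pos(1) unfolding c'_def by linarith
      qed
      have "inv x c \<in> {1..n}" "inv x d \<in> {1..n}" using pos_in_iff[OF xp, of c] pos_in_iff[OF xp, of d] cd by simp_all
      then have "c' \<in> {1..n}" "d' \<in> {1..n}"
        using pos_in_iff[OF xp, of c'] pos_in_iff[OF xp, of d'] pos k by auto
      then have "(c', d') \<in> desc n x"
        using pos k by (auto simp: desc_def vinv_iff c'_def d'_def)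
      then have "arc_inv (arc x (c', d')) \<subseteq> vinv n v" using sub by (auto simp: down_arcs_def)
      moreover have "(c, d) \<in> arc_inv (arc x (c', d'))"
        using \<open>c' \<le> c\<close> cd k pos by (auto simp: arc_inv_def arc_def c'_def d'_def)
      ultimately show ?thesis by blast
    qed
  qed
  then show ?thesis by auto
qed

lemma inj_down_arcs:
  assumes "x \<in> carrier L" "y \<in> carrier L" "down_arcs x = down_arcs y"
  shows "x = y"
proof -
  have *: "arc_inv \<alpha> \<subseteq> vinv n u" if "u \<in> carrier L" "\<alpha> \<in> down_arcs u" for u \<alpha>
  proof -
    obtain p q where "(p, q) \<in> desc n u" "\<alpha> = arc u (p, q)"
      using \<open>\<alpha> \<in> down_arcs u\<close> by (auto simp: down_arcs_def)
    then show ?thesis using \<open>u \<in> carrier L\<close> arc_inv_desc by (simp add: carrier_iff)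
  qed
  then have "vinv n x = vinv n y"
    using vinv_le_if_down_arcs[OF assms(1), of y] vinv_le_if_down_arcs[OF assms(2), of x]
      *[OF assms(1)] *[OF assms(2)] assms(3) by blast
  then show ?thesis using assms vinv_eq_iff by blast
qed

text \<open>The counterpart that makes rowmotion injective. An inversion \<open>(c, d)\<close> of
  \<open>y'\<close> missing in \<open>y\<close>, with \<open>c\<close> and \<open>d\<close> as close
  in \<open>y\<close> as possible, is straddled by an allowed ascent \<open>(c', d')\<close> of
  \<open>y\<close>. Since \<open>y'\<close> has the same arc, it cannot invert \<open>c\<close> and
  \<open>d\<close>.\<close>

lemma vinv_ge_if_up_arcs:
  assumes y: "y \<in> carrier L" and y': "y' \<in> carrier L" and sub: "up_arcs y \<subseteq> up_arcs y'"
  shows "vinv n y' \<subseteq> vinv n y"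
proof -
  have yp: "y permutes {1..n}" "vinv n y \<subseteq> vinv n w" using y by (auto simp: carrier_iff)
  have yp': "y' permutes {1..n}" "vinv n y' \<subseteq> vinv n w" using y' by (auto simp: carrier_iff)
  have "(c, d) \<in> vinv n y' \<Longrightarrow> (c, d) \<in> vinv n y" for c d
  proof (induction "inv y d - inv y c" arbitrary: c d rule: less_induct)
    case less
    from less.prems have cd: "1 \<le> c" "c < d" "d \<le> n" "inv y' d < inv y' c" by (auto simp: vinv_iff)
    show ?case
    proof (rule ccontr)
      assume "(c, d) \<notin> vinv n y"
      then have lt: "inv y c < inv y d"
        using cd pos_eq_iff[OF yp(1), of c d] by (auto simp: vinv_iff)
      have no: "\<not> (c < e \<and> e < d \<and> inv y c < inv y e \<and> inv y e < inv y d)" for e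
      proof
        assume e: "c < e \<and> e < d \<and> inv y c < inv y e \<and> inv y e < inv y d"
        then have "(c, e) \<in> vinv n y' \<or> (e, d) \<in> vinv n y'"
          using vinv_coclosed[OF less.prems] by blast
        moreover have "inv y e - inv y c < inv y d - inv y c" "inv y d - inv y e < inv y d - inv y c"
          using e by linarith+
        ultimately have "(c, e) \<in> vinv n y \<or> (e, d) \<in> vinv n y"
          using less.hyps by blast
        then show False using e by (auto simp: vinv_iff)
      qed
      have "y (inv y c) \<le> c" "\<not> y (inv y d) \<le> c" using cd yp by (auto simp: permutes_inverses)
      then obtain k where k: "inv y c \<le> k" "k < inv y d" "y k \<le> c" "\<not> y (Suc k) \<le> c"
        using exists_last_before[where P = "\<lambda>k. y k \<le> c"] lt by blast
      define c' d' where "c' = y k" and "d' = y (Suc k)"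
      have pos: "inv y c' = k" "inv y d' = Suc k"
        using yp by (auto simp: c'_def d'_def permutes_inverses)
      have "d \<le> d'"
      proof (cases "Suc k = inv y d")
        case True
        then have "inv y d' = inv y d" using pos(2) by (rule trans[rotated])
        then show ?thesis using pos_eq_iff[OF yp(1), of d' d] by (metis order_refl)
      next
        case False
        then show ?thesis using no[of d'] k pos(2) unfolding d'_def by linarith
      qed
      have "c' \<le> c" using k by (simp add: c'_def)
      have "inv y c \<in> {1..n}" "inv y d \<in> {1..n}" using pos_in_iff[OF yp(1), of c] pos_in_iff[OF yp(1), of d] cd by simp_all
      then have cd': "c' \<in> {1..n}" "d' \<in> {1..n}"
        using pos_in_iff[OF yp(1), of c'] pos_in_iff[OF yp(1), of d'] pos k by auto
      \<comment> \<open>The ascent is allowed because \<open>c'\<close>, \<open>c\<close>,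
        \<open>d\<close>, \<open>d'\<close>, up to repetitions, form a chain of inversions of
        \<open>w\<close>.\<close>
      have "c' = c \<or> (c', c) \<in> vinv n w"
      proof (cases "c' = c")
        case False
        then have "inv y c \<noteq> k" using pos(1) pos_eq_iff[OF yp(1), of c c'] by simp
        then have "(c', c) \<in> vinv n y" using \<open>c' \<le> c\<close> False k(1) pos(1) cd(2,3) cd'(1)
          unfolding vinv_iff by simp
        then show ?thesis using yp(2) by blast
      qed simp
      moreover have "d' = d \<or> (d, d') \<in> vinv n w"
      proof (cases "d' = d")
        case False
        then have "inv y d \<noteq> Suc k" using pos(2) pos_eq_iff[OF yp(1), of d d'] by simp
        then have "(d, d') \<in> vinv n y" using \<open>d \<le> d'\<close> False k(2) pos(2) cd(1,2) cd'(2)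
          unfolding vinv_iff by simp
        then show ?thesis using yp(2) by blast
      qed simp
      moreover have "(c, d) \<in> vinv n w" using less.prems yp'(2) by blast
      ultimately have "(c', d') \<in> vinv n w" using vinv_trans by blast
      then have "(c', d') \<in> asc n w y" using pos by (simp add: asc_def)
      then have "arc y (c', d') \<in> up_arcs y'" using sub by (auto simp: up_arcs_def)
      then obtain r s where "(r, s) \<in> asc n w y'" "arc y (c', d') = arc y' (r, s)"
        by (auto simp: up_arcs_def)
      then have adj: "inv y' d' = Suc (inv y' c')"
        and A: "{e. c' < e \<and> e < d' \<and> inv y e < inv y c'} = {e. c' < e \<and> e < d' \<and> inv y' e < inv y' c'}"
        by (auto simp: arc_def asc_def)
      \<comment> \<open>Equal third components put \<open>c\<close> weakly left of \<open>c'\<close>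
        and \<open>d\<close> weakly right of \<open>d'\<close> in \<open>y'\<close>.\<close>
      have "inv y' c \<le> inv y' c'"
      proof (cases "c = c'")
        case False
        then have "inv y c \<noteq> k" using pos(1) pos_eq_iff[OF yp(1), of c c'] by simp
        then have "c \<in> {e. c' < e \<and> e < d' \<and> inv y e < inv y c'}"
          using False \<open>c' \<le> c\<close> \<open>d \<le> d'\<close> k(1) pos(1) cd(2) by simp
        then show ?thesis unfolding A by auto
      qed simp
      moreover have "inv y' d' \<le> inv y' d"
      proof (cases "d = d'")
        case False
        have "d \<notin> {e. c' < e \<and> e < d' \<and> inv y e < inv y c'}" using k(2) pos(1) by simp
        then have "\<not> inv y' d < inv y' c'"
          unfolding A using False \<open>c' \<le> c\<close> \<open>d \<le> d'\<close> cd by auto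
        moreover have "d \<noteq> c'" using \<open>c' \<le> c\<close> cd by auto
        ultimately show ?thesis using adj pos_eq_iff[OF yp'(1), of d c'] by auto
      qed simp
      ultimately show False using adj cd by auto
    qed
  qed
  then show ?thesis by auto
qed

lemma inj_up_arcs:
  assumes "x \<in> carrier L" "y \<in> carrier L" "up_arcs x = up_arcs y"
  shows "x = y"
  using assms vinv_ge_if_up_arcs[of x y] vinv_ge_if_up_arcs[of y x] vinv_eq_iff by auto

lemma arc_inv_asc:
  assumes y: "y \<in> carrier L" and a: "(p, q) \<in> asc n w y"
  shows "arc_inv (arc y (p, q)) \<subseteq> insert (p, q) (vinv n y)"
proof -
  have yp: "y permutes {1..n}" using y by (auto simp: carrier_iff)
  have pq: "1 \<le> p" "p < q" "q \<le> n" "inv y q = Suc (inv y p)" using a by (auto simp: asc_def vinv_iff)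
  let ?z = "transpose p q \<circ> y"
  note z = vinv_swap_up[OF yp pq(4,1-3)]
  have "(p, q) \<in> desc n ?z" using pq by (auto simp: desc_def z inv_transpose_comp[OF yp])
  then show ?thesis using arc_inv_desc[OF z(1)] z(2) arc_swap[OF yp a] by fastforce
qed

text \<open>The image is the join \<open>x\<close> of the labels of the allowed ascents, whose
  inversion set is the closure of \<open>G\<close>. Each such ascent becomes a descent of
  \<open>x\<close> with the same arc, and no other descents arise.\<close>

lemma exists_down_arcs_eq_up_arcs:
  assumes y: "y \<in> carrier L"
  shows "\<exists>x \<in> carrier L. down_arcs x = up_arcs y"
proof -
  have yp: "y permutes {1..n}" "vinv n y \<subseteq> vinv n w" using y by (auto simp: carrier_iff)
  define G where "G = (\<Union>\<alpha> \<in> up_arcs y. arc_inv \<alpha>)"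
  have G_step: "(a, b) \<in> vinv n y \<or> (a, b) \<in> asc n w y" if "(a, b) \<in> G" for a b
  proof -
    obtain p q where "(p, q) \<in> asc n w y" "(a, b) \<in> arc_inv (arc y (p, q))"
      using \<open>(a, b) \<in> G\<close> by (auto simp: G_def up_arcs_def)
    then show ?thesis using arc_inv_asc[OF y] by blast
  qed
  have G_w: "G \<subseteq> vinv n w"
    using G_step yp(2) by (auto simp: asc_def)
  have G_lt: "a < b" if "(a, b) \<in> G" for a b using G_w that by (auto simp: vinv_iff)
  have G_le: "a \<le> b" if "(a, b) \<in> G\<^sup>*" for a b
    using that by induction (auto dest: G_lt)
  \<comment> \<open>A step of \<open>G\<close> moves left in \<open>y\<close> or exactly one place right, so a path from left to right visits
    every position in between.\<close>
  have visit: "(a, y k) \<in> G\<^sup>* \<and> (y k, b) \<in> G\<^sup>*" if "(a, b) \<in> G\<^sup>*" "inv y a \<le> k" "k \<le> inv y b" for a b k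
    using that
  proof (induction rule: rtrancl_induct)
    case base
    then have "k = inv y a" by simp
    then show ?case using yp(1) by (simp add: permutes_inverses)
  next
    case (step b c)
    show ?case
    proof (cases "k \<le> inv y b")
      case True
      then show ?thesis using step by (meson rtrancl.rtrancl_into_rtrancl)
    next
      case False
      then have "k = inv y c"
        using G_step[OF step.hyps(2)] step.prems by (auto simp: vinv_iff asc_def)
      then have "y k = c" using yp(1) by (simp add: permutes_inverses)
      then show ?thesis using step.hyps by auto
    qed
  qed
  have G_arc: "arc_inv (arc y (p, q)) \<subseteq> G" if "(p, q) \<in> asc n w y" for p q
    using that by (auto simp: G_def up_arcs_def)
  have "\<exists>x. x permutes {1..n} \<and> vinv n x = G\<^sup>+"
  proof (rule trancl_vinv_exists)
    show "1 \<le> p \<and> p < q \<and> q \<le> n" if "(p, q) \<in> G" for p q using that G_w by (auto simp: vinv_iff)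
    show "(p, q) \<in> G \<or> (q, r) \<in> G" if "(p, r) \<in> G" "p < q" "q < r" for p q r
      using that arc_inv_coclosed unfolding G_def by blast
  qed
  then obtain x where xp: "x permutes {1..n}" and x_G: "vinv n x = G\<^sup>+" by blast
  have "G\<^sup>+ \<subseteq> vinv n w"
    using trancl_mono_subset[OF G_w] trancl_id[OF trans_vinv] by auto
  then have xc: "x \<in> carrier L" using xp x_G by (simp add: carrier_iff)
  have x_iff: "inv x d < inv x c \<longleftrightarrow> (c, d) \<in> G\<^sup>+" if "1 \<le> c" "c < d" "d \<le> n" for c d
    using that unfolding x_G[symmetric] by (simp add: vinv_iff)
  have x_iff': "inv x c < inv x d \<longleftrightarrow> (c, d) \<notin> G\<^sup>+" if "1 \<le> c" "c < d" "d \<le> n" for c d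
    using x_iff[OF that] pos_eq_iff[OF xp, of c d] that by auto
  have key: "(p, q) \<in> desc n x \<and> arc x (p, q) = arc y (p, q)" if a: "(p, q) \<in> asc n w y" for p q
  proof -
    have pq: "1 \<le> p" "p < q" "q \<le> n" "inv y q = Suc (inv y p)" using a by (auto simp: asc_def vinv_iff)
    have y_pq: "y (inv y p) = p" "y (Suc (inv y p)) = q"
      using permutes_inverses(1)[OF yp(1)] pq(4)[symmetric] by simp_all
    have "(p, q) \<in> arc_inv (arc y (p, q))" using pq by (auto simp: arc_inv_def arc_def)
    then have "(p, q) \<in> G" using G_arc[OF a] by blast
    then have pqG: "(p, q) \<in> G\<^sup>+" by blast
    \<comment> \<open>Such a path would visit \<open>p\<close>, which stands immediately before
      \<open>q\<close>, although \<open>p\<close> is smaller than \<open>e\<close>.\<close>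
    have left: "(e, q) \<notin> G\<^sup>+" if "p < e" "e < q" "inv y e < inv y p" for e
    proof
      assume "(e, q) \<in> G\<^sup>+"
      then have "(e, q) \<in> G\<^sup>*" by (rule trancl_into_rtrancl)
      then have "(e, p) \<in> G\<^sup>*" using visit[of e q "inv y p"] that(3) pq(4) y_pq(1) by simp
      then show False using G_le[of e p] that by simp
    qed
    have right: "(p, e) \<notin> G\<^sup>+" if "p < e" "e < q" "\<not> inv y e < inv y p" for e
    proof
      assume "(p, e) \<in> G\<^sup>+"
      then have "(p, e) \<in> G\<^sup>*" by (rule trancl_into_rtrancl)
      moreover have "inv y e \<noteq> inv y p" using pos_eq_iff[OF yp(1), of e p] that by simp
      ultimately have "(q, e) \<in> G\<^sup>*"
        using visit[of p e "Suc (inv y p)"] that(3) y_pq(2) by simp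
      then show False using G_le[of q e] that by simp
    qed
    \<comment> \<open>\<open>above\<close> and \<open>below\<close> keep values outside the range
      from \<open>p\<close> to \<open>q\<close> from separating the two in \<open>x\<close>. A step
      that jumps over \<open>q\<close> can be replaced by one from \<open>q\<close>, unless
      \<open>q\<close> stands left of the arc's lower end \<open>r\<close>; then the path has
      visited \<open>q\<close> before the jump, against the order.\<close>
    have above: "(q, e) \<in> G\<^sup>+" if e: "q < e" "(p, e) \<in> G\<^sup>+" for e
    proof -
      consider "(q, e) \<in> G\<^sup>*" | i j where "(p, i) \<in> G\<^sup>*" "(i, j) \<in> G" "(j, e) \<in> G\<^sup>*" "i < q" "q < j"
        using rtrancl_crossing[OF trancl_into_rtrancl[OF e(2)], of q] e(1) pq(2) by fastforce
      then show ?thesis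
      proof cases
        case 1
        then show ?thesis using e(1) by (auto simp: rtrancl_eq_or_trancl)
      next
        case 2
        then obtain r s where rs: "(r, s) \<in> asc n w y" "(i, j) \<in> arc_inv (arc y (r, s))"
          by (auto simp: G_def up_arcs_def)
        show ?thesis
        proof (cases "inv y q < inv y r")
          case True
          have "inv y r \<le> inv y i" using rs(2) by (cases "i = r") (auto simp: arc_inv_def arc_def)
          then have "(q, i) \<in> G\<^sup>*"
            using visit[OF 2(1), of "Suc (inv y p)"] True pq(4) y_pq(2) by simp
          then show ?thesis using G_le[of q i] 2(4) by simp
        next
          case False
          then have "(q, j) \<in> arc_inv (arc y (r, s))" using rs(2) 2 by (auto simp: arc_inv_def arc_def)
          then show ?thesis using G_arc[OF rs(1)] 2(3) by (blast intro: rtrancl_into_trancl2)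
        qed
      qed
    qed
    have below: "(e, p) \<in> G\<^sup>+" if e: "e < p" "(e, q) \<in> G\<^sup>+" for e
    proof -
      consider "(e, p) \<in> G\<^sup>*" | i j where "(e, i) \<in> G\<^sup>*" "(i, j) \<in> G" "(j, q) \<in> G\<^sup>*" "i < p" "p < j"
        using rtrancl_crossing[OF trancl_into_rtrancl[OF e(2)], of p] e(1) pq(2) by fastforce
      then show ?thesis
      proof cases
        case 1
        then show ?thesis using e(1) by (auto simp: rtrancl_eq_or_trancl)
      next
        case 2
        then obtain r s where rs: "(r, s) \<in> asc n w y" "(i, j) \<in> arc_inv (arc y (r, s))"
          by (auto simp: G_def up_arcs_def)
        show ?thesis
        proof (cases "inv y p < inv y r")
          case True
          then have "(i, p) \<in> arc_inv (arc y (r, s))" using rs(2) 2 by (auto simp: arc_inv_def arc_def)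
          then show ?thesis using G_arc[OF rs(1)] 2(1) by (blast intro: rtrancl_into_trancl1)
        next
          case False
          have "r \<noteq> p" using rs(2) 2 by (auto simp: arc_inv_def arc_def)
          then have "inv y r < inv y p" using False pos_eq_iff[OF yp(1), of r p] by auto
          moreover have "inv y j \<le> Suc (inv y r)"
            using rs by (auto simp: arc_inv_def arc_def asc_def)
          ultimately have "(j, p) \<in> G\<^sup>*"
            using visit[OF 2(3), of "inv y p"] pq(4) y_pq(1) by simp
          then show ?thesis using G_le[of j p] 2(5) by simp
        qed
      qed
    qed
    have lt: "inv x q < inv x p" using x_iff pq pqG by blast
    \<comment> \<open>According to its size, a value standing between \<open>q\<close> and
      \<open>p\<close> in \<open>x\<close> is excluded by \<open>below\<close>, by
      \<open>left\<close> and \<open>right\<close>, or by \<open>above\<close>.\<close>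
    have adj: "inv x p = Suc (inv x q)"
    proof (rule ccontr)
      assume "inv x p \<noteq> Suc (inv x q)"
      define e where "e = x (Suc (inv x q))"
      have pe: "inv x e = Suc (inv x q)" unfolding e_def using xp by (simp add: permutes_inverses)
      then have e: "inv x q < inv x e" "inv x e < inv x p" using lt \<open>inv x p \<noteq> _\<close> by auto
      have "inv x p \<in> {1..n}" "inv x q \<in> {1..n}" using pos_in_iff[OF xp, of p] pos_in_iff[OF xp, of q] pq by simp_all
      then have en: "1 \<le> e" "e \<le> n" using pos_in_iff[OF xp, of e] e by auto
      have "p \<noteq> e" "e \<noteq> q" using e by auto
      then consider "e < p" | "p < e" "e < q" | "q < e" by linarith
      then show False
      proof cases
        case 1
        then show False using below x_iff[of e q] x_iff[of e p] e en pq by auto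
      next
        case 2
        then show False using left[OF 2] right[OF 2] x_iff[of e q] x_iff[of p e] e en pq by auto
      next
        case 3
        then show False using above x_iff[of q e] x_iff[of p e] e en pq by auto
      qed
    qed
    have "inv x e < inv x p \<longleftrightarrow> inv y e < inv y p" if "p < e" "e < q" for e
    proof
      assume "inv x e < inv x p"
      then show "inv y e < inv y p" using right[OF that] x_iff[of p e] that pq by auto
    next
      assume "inv y e < inv y p"
      then show "inv x e < inv x p" using left[OF that] x_iff'[of e q] that pq lt by auto
    qed
    then have "arc x (p, q) = arc y (p, q)" by (auto simp: arc_def)
    then show ?thesis using adj pqG by (auto simp: desc_def x_G)
  qed
  \<comment> \<open>A descent of \<open>x\<close> is a single step of \<open>G\<close>, for an
    intermediate point of the path would stand between its values. Comparison with the descent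
    \<open>(r, s)\<close> whose arc contains this step identifies the two.\<close>
  have "(p, q) \<in> asc n w y" if d: "(p, q) \<in> desc n x" for p q
  proof -
    have adj: "inv x p = Suc (inv x q)" using d by (simp add: desc_def)
    have "(p, q) \<in> G\<^sup>+" using d by (simp add: desc_def x_G)
    then have "(p, q) \<in> G"
    proof (cases rule: tranclE)
      case (step c)
      then have "(p, c) \<in> vinv n x" "(c, q) \<in> vinv n x" by (auto simp: x_G)
      then show ?thesis using adj by (auto simp: vinv_iff)
    qed
    then obtain r s where rs: "(r, s) \<in> asc n w y" "(p, q) \<in> arc_inv (arc y (r, s))"
      by (auto simp: G_def up_arcs_def)
    then have pq: "(p, q) \<in> arc_inv (arc x (r, s))" and rs': "(r, s) \<in> desc n x" using key by auto
    have "inv x r \<le> inv x p" using pq by (cases "p = r") (auto simp: arc_inv_def arc_def)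
    moreover have "q = s \<or> inv x q < inv x s"
      using pq rs' pos_eq_iff[OF xp, of q s] by (auto simp: arc_inv_def arc_def desc_def)
    moreover have "inv x r = Suc (inv x s)" using rs' by (simp add: desc_def)
    ultimately have "q = s" "inv x p = inv x r" using adj by auto
    then show ?thesis using rs(1) pos_eq_iff[OF xp, of p r] by simp
  qed
  then have "desc n x = asc n w y" using key by auto
  moreover have "arc x z = arc y z" if "z \<in> asc n w y" for z
    using key[of "fst z" "snd z"] that by simp
  ultimately have "down_arcs x = up_arcs y"
    unfolding down_arcs_def up_arcs_def by (intro image_cong) auto
  then show ?thesis using xc by blast
qed

lemma row_props:
  assumes y: "y \<in> carrier L"
  shows "row L y \<in> carrier L" "down_arcs (row L y) = up_arcs y"
proof -
  have "\<exists>!x. x \<in> carrier L \<and> down_labels L x = up_labels L y"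
  proof (rule ex_ex1I)
    show "\<exists>x. x \<in> carrier L \<and> down_labels L x = up_labels L y"
      using exists_down_arcs_eq_up_arcs[OF y] labels_eq_iff[OF _ y] by blast
    show "x = z" if "x \<in> carrier L \<and> down_labels L x = up_labels L y"
      "z \<in> carrier L \<and> down_labels L z = up_labels L y" for x z
    proof -
      have "down_arcs x = down_arcs z" using that labels_eq_iff[OF _ y] by metis
      then show ?thesis using inj_down_arcs that by blast
    qed
  qed
  from theI'[OF this] show "row L y \<in> carrier L" "down_arcs (row L y) = up_arcs y"
    using labels_eq_iff[OF _ y] by (auto simp: row_def)
qed

lemma bij_row: "bij_betw (row L) (carrier L) (carrier L)"
proof -
  have "inj_on (row L) (carrier L)"
  proof (rule inj_onI)
    fix x y assume xy: "x \<in> carrier L" "y \<in> carrier L" "row L x = row L y"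
    then have "up_arcs x = up_arcs y" using row_props(2)[OF xy(1)] row_props(2)[OF xy(2)] by simp
    then show "x = y" using inj_up_arcs xy by simp
  qed
  moreover have "row L ` carrier L \<subseteq> carrier L" using row_props by blast
  ultimately show ?thesis
    using endo_inj_surj[OF finite_carrier] by (simp add: bij_betw_def)
qed

end

section \<open>Rooks\<close>

lemma arc_inject: "arc u z = arc u z' \<longleftrightarrow> z = z'"
  by (cases z; cases z') (auto simp: arc_def)

lemma inj_arc: "inj_on (arc u) S"
  by (simp add: inj_on_def arc_inject)

lemma orbit_bij_betw:
  assumes "bij_betw f X X" "finite X" "x \<in> X"
  shows "orbit f x \<subseteq> X" "bij_betw f (orbit f x) (orbit f x)"
proof -
  have maps: "f y \<in> X" if "y \<in> X" for y using assms(1) that by (auto simp: bij_betw_def)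
  show sub: "orbit f x \<subseteq> X"
  proof
    fix y assume "y \<in> orbit f x"
    then show "y \<in> X" by induction (use maps assms(3) in auto)
  qed
  have "inj_on f (orbit f x)" using assms(1) sub by (auto simp: bij_betw_def intro: inj_on_subset)
  moreover have "f ` orbit f x \<subseteq> orbit f x" by (auto intro: orbit.step)
  ultimately show "bij_betw f (orbit f x) (orbit f x)"
    using endo_inj_surj finite_subset[OF sub assms(2)] by (simp add: bij_betw_def)
qed

lemma sum_of_bool_eq: "finite S \<Longrightarrow> T \<subseteq> S \<Longrightarrow> (\<Sum>z\<in>T. c z) = (\<Sum>z\<in>S. of_bool (z \<in> T) * c z)"
  for c :: "'a \<Rightarrow> real"
  by (simp add: of_bool_def if_distrib[of "\<lambda>a. a * _"] sum.If_cases Int_absorb1 cong: if_cong)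

context weak_initial_interval
begin

lemma desc_subset: "u \<in> carrier L \<Longrightarrow> desc n u \<subseteq> vinv n w"
  by (auto simp: desc_def carrier_iff)

section \<open>Sums over ascents and descents along an orbit\<close>

text \<open>Indexing by the position of the first letter prepares the telescoping in
  \<open>rook_identity\<close>.\<close>

lemma sum_asc:
  fixes f :: "nat \<times> nat \<Rightarrow> real"
  assumes u: "u \<in> carrier L"
  shows "(\<Sum>z\<in>asc n w u. f z) =
    (\<Sum>k\<in>{1..<n}. if (u k, u (Suc k)) \<in> vinv n w then f (u k, u (Suc k)) else 0)"
proof -
  have up: "u permutes {1..n}" using u by (simp add: carrier_iff)
  let ?g = "\<lambda>k. (u k, u (Suc k))"
  have "asc n w u = ?g ` {k \<in> {1..<n}. ?g k \<in> vinv n w}"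
  proof (intro equalityI subsetI)
    fix z assume "z \<in> asc n w u"
    then obtain p q where z: "z = (p, q)" "(p, q) \<in> vinv n w" "inv u q = Suc (inv u p)"
      by (auto simp: asc_def)
    then have "inv u p \<in> {1..n}" "inv u q \<in> {1..n}"
      using pos_in_iff[OF up, of p] pos_in_iff[OF up, of q] by (auto simp: vinv_iff)
    moreover have "?g (inv u p) = z"
      using z permutes_inverses(1)[OF up] by (metis z(3))
    ultimately show "z \<in> ?g ` {k \<in> {1..<n}. ?g k \<in> vinv n w}"
      using z by (intro image_eqI[of _ _ "inv u p"]) auto
  qed (auto simp: asc_def permutes_inverses[OF up])
  moreover have "inj_on ?g S" for S
    using permutes_inj[OF up] by (auto simp: inj_on_def)
  ultimately have "(\<Sum>z\<in>asc n w u. f z) = (\<Sum>k\<in>{k \<in> {1..<n}. ?g k \<in> vinv n w}. f (?g k))"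
    by (simp add: sum.reindex)
  then show ?thesis by (simp only: sum.inter_filter finite_atLeastLessThan)
qed

lemma sum_desc:
  fixes f :: "nat \<times> nat \<Rightarrow> real"
  assumes u: "u \<in> carrier L"
  shows "(\<Sum>z\<in>desc n u. f z) =
    (\<Sum>k\<in>{1..<n}. if u (Suc k) < u k then f (u (Suc k), u k) else 0)"
proof -
  have up: "u permutes {1..n}" using u by (simp add: carrier_iff)
  let ?g = "\<lambda>k. (u (Suc k), u k)"
  have "desc n u = ?g ` {k \<in> {1..<n}. u (Suc k) < u k}"
  proof (intro equalityI subsetI)
    fix z assume "z \<in> desc n u"
    then obtain p q where z: "z = (p, q)" "(p, q) \<in> vinv n u" "inv u p = Suc (inv u q)"
      by (auto simp: desc_def)
    then have "inv u p \<in> {1..n}" "inv u q \<in> {1..n}"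
      using pos_in_iff[OF up, of p] pos_in_iff[OF up, of q] by (auto simp: vinv_iff)
    moreover have "?g (inv u q) = z"
      using z permutes_inverses(1)[OF up] by (metis z(3))
    ultimately show "z \<in> ?g ` {k \<in> {1..<n}. u (Suc k) < u k}"
      using z by (intro image_eqI[of _ _ "inv u q"]) (auto simp: vinv_iff)
  next
    fix z assume "z \<in> ?g ` {k \<in> {1..<n}. u (Suc k) < u k}"
    then obtain k where k: "z = ?g k" "k \<in> {1..<n}" "u (Suc k) < u k" by auto
    then have "u k \<in> {1..n}" "u (Suc k) \<in> {1..n}"
      using permutes_in_image[OF up, of k] permutes_in_image[OF up, of "Suc k"] by auto
    then show "z \<in> desc n u" using k by (auto simp: desc_def vinv_iff permutes_inverses[OF up])
  qed
  moreover have "inj_on ?g S" for S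
    using permutes_inj[OF up] by (auto simp: inj_on_def)
  ultimately have "(\<Sum>z\<in>desc n u. f z) = (\<Sum>k\<in>{k \<in> {1..<n}. u (Suc k) < u k}. f (?g k))"
    by (simp add: sum.reindex)
  then show ?thesis by (simp only: sum.inter_filter finite_atLeastLessThan)
qed

lemma orbit_sum_arcs:
  fixes F :: "nat \<times> nat \<times> nat set \<Rightarrow> real"
  assumes x: "x \<in> carrier L"
  shows "(\<Sum>v\<in>orbit (row L) x. \<Sum>z\<in>asc n w v. F (arc v z)) =
    (\<Sum>v\<in>orbit (row L) x. \<Sum>z\<in>desc n v. F (arc v z))"
proof -
  note O = orbit_bij_betw[OF bij_row finite_carrier x]
  have up: "(\<Sum>z\<in>asc n w v. F (arc v z)) = sum F (up_arcs v)"
    and down: "(\<Sum>z\<in>desc n v. F (arc v z)) = sum F (down_arcs v)" for v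
    by (simp_all add: up_arcs_def down_arcs_def sum.reindex[OF inj_arc])
  have "(\<Sum>v\<in>orbit (row L) x. sum F (up_arcs v)) =
    (\<Sum>v\<in>orbit (row L) x. sum F (down_arcs (row L v)))"
    using O(1) row_props(2) by (intro sum.cong) auto
  also have "\<dots> = (\<Sum>v\<in>orbit (row L) x. sum F (down_arcs v))"
    by (rule sum.reindex_bij_betw[OF O(2)])
  finally show ?thesis by (simp add: up down)
qed

section \<open>Boxes whose row and column span a full rectangle\<close>

definition full_hook :: "nat \<Rightarrow> nat \<Rightarrow> bool" where
  "full_hook p q \<longleftrightarrow> (p, q) \<in> vinv n w \<and>
     (\<forall>x y. (x, q) \<in> vinv n w \<longrightarrow> (p, y) \<in> vinv n w \<longrightarrow> (x, y) \<in> vinv n w)"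

text \<open>Otherwise \<open>x = y = e\<close> in the definition would make \<open>(e, e)\<close> an
  inversion.\<close>

lemma full_hook_excl: "full_hook p q \<Longrightarrow> \<not> ((e, q) \<in> vinv n w \<and> (p, e) \<in> vinv n w)"
  using vinv_iff[of e e] by (fastforce simp: full_hook_def)

text \<open>By \<open>full_hook_excl\<close> at most one membership holds. A value between
  \<open>p\<close> and \<open>q\<close> in size splits the pair \<open>(p, q)\<close>; a smaller one
  has \<open>p\<close> or \<open>q\<close> on its left, a larger one has \<open>p\<close> or
  \<open>q\<close> on its right, and the resulting inversion gives the other half.\<close>

lemma full_hook_between:
  assumes u: "u \<in> carrier L" and h: "full_hook p q"
    and e: "(inv u p \<le> inv u e \<and> inv u e \<le> inv u q) \<or> (inv u q \<le> inv u e \<and> inv u e \<le> inv u p)"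
  shows "(p, e) \<in> vinv n w \<longleftrightarrow> (e, q) \<notin> vinv n w"
proof -
  have up: "u permutes {1..n}" and sub: "vinv n u \<subseteq> vinv n w" using u by (auto simp: carrier_iff)
  have pq: "(p, q) \<in> vinv n w" using h by (simp add: full_hook_def)
  then have pq': "1 \<le> p" "p < q" "q \<le> n" by (auto simp: vinv_iff)
  have "inv u p \<in> {1..n}" "inv u q \<in> {1..n}"
    using pos_in_iff[OF up, of p] pos_in_iff[OF up, of q] pq' by simp_all
  then have "inv u e \<in> {1..n}" using e by auto
  then have en: "1 \<le> e" "e \<le> n" using pos_in_iff[OF up, of e] by simp_all
  consider "e = p" | "e = q" | "p < e" "e < q" | "e < p" | "q < e" by linarith
  then have "(p, e) \<in> vinv n w \<or> (e, q) \<in> vinv n w"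
  proof cases
    case 3
    then show ?thesis using vinv_coclosed[OF pq] by blast
  next
    case 4
    then have "inv u p \<noteq> inv u e" using pos_eq_iff[OF up, of p e] by simp
    then have "(e, p) \<in> vinv n u \<or> (e, q) \<in> vinv n u"
      using 4 e en pq' pos_eq_iff[OF up, of q e] unfolding vinv_iff by linarith
    then show ?thesis using sub vinv_trans[OF _ pq] by blast
  next
    case 5
    then have "inv u q \<noteq> inv u e" using pos_eq_iff[OF up, of q e] by simp
    then have "(q, e) \<in> vinv n u \<or> (p, e) \<in> vinv n u"
      using 5 e en pq' pos_eq_iff[OF up, of p e] unfolding vinv_iff by linarith
    then show ?thesis using sub vinv_trans[OF pq] by blast
  qed (use pq in auto)
  then show ?thesis using full_hook_excl[OF h, of e] by blast
qed

text \<open>The weights of ascents and descents in the signed count of steps: for an adjacent pair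
  \<open>x \<in> X\<close>, \<open>y \<in> Y\<close> the condition \<open>p \<le> x \<or> p \<in> A\<close> says that \<open>p\<close> does not stand to the right of \<open>x\<close>,
  and \<open>y \<le> q \<or> q \<notin> A\<close> that \<open>q\<close> does not stand to the left of \<open>y\<close>; see \<open>rook_conds\<close>. They depend on
  the arc only, and their sum is concentrated on the row and column of the box.\<close>

definition rook_up :: "nat \<Rightarrow> nat \<Rightarrow> nat \<times> nat \<times> nat set \<Rightarrow> real" where
  "rook_up p q = (\<lambda>(x, y, A). of_bool ((x, q) \<in> vinv n w \<and> (p, y) \<in> vinv n w) *
     (of_bool ((p \<le> x \<or> p \<in> A) \<and> (y \<le> q \<or> q \<notin> A))
      - of_bool (\<not> (p \<le> x \<or> p \<in> A) \<and> \<not> (y \<le> q \<or> q \<notin> A))))"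

definition rook_down :: "nat \<Rightarrow> nat \<Rightarrow> nat \<times> nat \<times> nat set \<Rightarrow> real" where
  "rook_down p q = (\<lambda>(x, y, A). of_bool ((x, q) \<in> vinv n w \<and> (p, y) \<in> vinv n w) *
     (of_bool ((x = p \<or> \<not> (p \<le> x \<or> p \<in> A)) \<and> (y = q \<or> \<not> (y \<le> q \<or> q \<notin> A)))
      - of_bool (x \<noteq> p \<and> y \<noteq> q \<and> (p \<le> x \<or> p \<in> A) \<and> (y \<le> q \<or> q \<notin> A))))"

text \<open>If \<open>x = p\<close> or \<open>y = q\<close>, the assumptions make the common factor
  of the weights one; otherwise the two weights cancel.\<close>

lemma rook_up_plus_down:
  assumes "(x, y) \<in> vinv n w" "(p, q) \<in> vinv n w"
  shows "rook_up p q (x, y, A) + rook_down p q (x, y, A) = of_bool (x = p) + of_bool (y = q)"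
proof -
  let ?a = "p \<le> x \<or> p \<in> A" and ?b = "y \<le> q \<or> q \<notin> A"
  have "x = p \<Longrightarrow> ?a" "y = q \<Longrightarrow> ?b" by auto
  then show ?thesis
    using assms unfolding rook_up_def rook_down_def prod.case
    by (cases ?a; cases ?b; cases "x = p"; cases "y = q") auto
qed

text \<open>If \<open>p < x\<close>, the arc does not record where \<open>p\<close> stands, but
  \<open>p\<close> right of \<open>x\<close> would contradict \<open>full_hook_excl\<close>;
  similarly for \<open>y < q\<close>. Adjacency lets \<open>A\<close>, which refers to
  \<open>x\<close>, compare \<open>q\<close> with \<open>y\<close> as well.\<close>

lemma rook_conds:
  assumes u: "u \<in> carrier L" and h: "full_hook p q"
    and xy: "(x, q) \<in> vinv n w" "(p, y) \<in> vinv n w"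
    and adj: "inv u y = Suc (inv u x) \<or> inv u x = Suc (inv u y)"
    and A: "A = {c. x < c \<and> c < y \<and> inv u c < inv u x}"
  shows "p \<le> x \<or> p \<in> A \<longleftrightarrow> inv u p \<le> inv u x" "y \<le> q \<or> q \<notin> A \<longleftrightarrow> inv u y \<le> inv u q"
proof -
  have up: "u permutes {1..n}" and sub: "vinv n u \<subseteq> vinv n w" using u by (auto simp: carrier_iff)
  have bounds: "1 \<le> p" "p < y" "y \<le> n" "1 \<le> x" "x < q" "q \<le> n" using xy by (auto simp: vinv_iff)
  show "p \<le> x \<or> p \<in> A \<longleftrightarrow> inv u p \<le> inv u x"
  proof (cases p x rule: linorder_cases)
    case less
    have "\<not> inv u x < inv u p"
    proof
      assume "inv u x < inv u p"
      then have "(p, x) \<in> vinv n u" using less bounds by (simp add: vinv_iff)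
      then show False using full_hook_excl[OF h, of x] sub xy by blast
    qed
    then show ?thesis using less by simp
  next
    case greater
    then have "inv u p \<noteq> inv u x" using pos_eq_iff[OF up, of p x] by simp
    then show ?thesis using greater bounds by (auto simp: A)
  qed simp
  show "y \<le> q \<or> q \<notin> A \<longleftrightarrow> inv u y \<le> inv u q"
  proof (cases y q rule: linorder_cases)
    case less
    have "\<not> inv u q < inv u y"
    proof
      assume "inv u q < inv u y"
      then have "(y, q) \<in> vinv n u" using less bounds by (simp add: vinv_iff)
      then show False using full_hook_excl[OF h, of y] sub xy by blast
    qed
    then show ?thesis using less by simp
  next
    case greater
    then have "inv u q \<noteq> inv u y" "inv u q \<noteq> inv u x"
      using pos_eq_iff[OF up, of q y] pos_eq_iff[OF up, of q x] bounds by simp_all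
    then have "inv u q < inv u x \<longleftrightarrow> \<not> inv u y \<le> inv u q" using adj by linarith
    then show ?thesis using greater bounds by (auto simp: A)
  qed simp
qed

text \<open>The weights add up to the signed number of entries into \<open>Y\<close> on the stretch
  from \<open>p\<close> to \<open>q\<close>, where \<open>p\<close> lies outside \<open>Y\<close>
  and \<open>q\<close> inside.\<close>

lemma rook_identity:
  assumes u: "u \<in> carrier L" and h: "full_hook p q"
  shows "(\<Sum>z\<in>asc n w u. rook_up p q (arc u z)) + (\<Sum>z\<in>desc n u. rook_down p q (arc u z)) = 1"
proof -
  have up: "u permutes {1..n}" and sub: "vinv n u \<subseteq> vinv n w" using u by (auto simp: carrier_iff)
  have pq: "(p, q) \<in> vinv n w" and H: "\<And>x y. (x, q) \<in> vinv n w \<Longrightarrow> (p, y) \<in> vinv n w \<Longrightarrow> (x, y) \<in> vinv n w"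
    using h by (auto simp: full_hook_def)
  have pq': "1 \<le> p" "p < q" "q \<le> n" using pq by (auto simp: vinv_iff)
  have posr: "inv u p \<in> {1..n}" "inv u q \<in> {1..n}"
    using pos_in_iff[OF up, of p] pos_in_iff[OF up, of q] pq' by simp_all
  have posu: "inv u (u k) = k" for k using up by (simp add: permutes_inverses)
  define X Y where "X k \<longleftrightarrow> (u k, q) \<in> vinv n w" and "Y k \<longleftrightarrow> (p, u k) \<in> vinv n w" for k
  \<comment> \<open>The sign is \<open>1\<close> on the stretch if \<open>p\<close> stands left of
    \<open>q\<close>, \<open>-1\<close> if it stands right of \<open>q\<close>, and \<open>0\<close>
    outside.\<close>
  define s :: "nat \<Rightarrow> real" where
    "s k = of_bool (inv u p \<le> k \<and> k < inv u q) - of_bool (inv u q \<le> k \<and> k < inv u p)" for k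
  \<comment> \<open>Whenever the weight is nonzero, the guard holds by the rectangle condition
    \<open>H\<close>.\<close>
  have F: "(if (u k, u (Suc k)) \<in> vinv n w then rook_up p q (arc u (u k, u (Suc k))) else 0) =
      s k * of_bool (X k \<and> Y (Suc k))" for k
  proof (cases "X k \<and> Y (Suc k)")
    case True
    then have xy: "(u k, q) \<in> vinv n w" "(p, u (Suc k)) \<in> vinv n w" by (simp_all add: X_def Y_def)
    note c = rook_conds[OF u h xy _ refl, unfolded posu, simplified]
    have "rook_up p q (arc u (u k, u (Suc k))) = s k"
      unfolding rook_up_def arc_def s_def prod.case posu using xy c by (auto simp: of_bool_def)
    then show ?thesis using True H[OF xy] by simp
  next
    case False
    then show ?thesis by (auto simp: rook_up_def arc_def X_def Y_def)
  qed
  have G: "(if u (Suc k) < u k then rook_down p q (arc u (u (Suc k), u k)) else 0) =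
      - s k * of_bool (X (Suc k) \<and> Y k)" for k
  proof (cases "X (Suc k) \<and> Y k")
    case True
    then have xy: "(u (Suc k), q) \<in> vinv n w" "(p, u k) \<in> vinv n w" by (simp_all add: X_def Y_def)
    have eqs: "u (Suc k) = p \<longleftrightarrow> inv u p = Suc k" "u k = q \<longleftrightarrow> inv u q = k"
      using up posu by (metis permutes_inverses(1))+
    note c = rook_conds[OF u h xy _ refl, unfolded posu, simplified]
    have "rook_down p q (arc u (u (Suc k), u k)) = - s k"
      unfolding rook_down_def arc_def s_def prod.case posu eqs using xy c by (auto simp: of_bool_def)
    moreover have "u (Suc k) < u k" using H[OF xy] by (simp add: vinv_iff)
    ultimately show ?thesis using True by simp
  next
    case False
    then show ?thesis by (auto simp: rook_down_def arc_def X_def Y_def)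
  qed
  \<comment> \<open>On the stretch \<open>X\<close> is the complement of \<open>Y\<close>, so the
    two types of steps combine to the change of \<open>Y\<close>.\<close>
  have step: "s k * of_bool (X k \<and> Y (Suc k)) - s k * of_bool (X (Suc k) \<and> Y k) =
      s k * (of_bool (Y (Suc k)) - of_bool (Y k))" for k
  proof (cases "s k = 0")
    case False
    then have "(inv u p \<le> k \<and> k < inv u q) \<or> (inv u q \<le> k \<and> k < inv u p)"
      by (auto simp: s_def)
    then have "Y k \<longleftrightarrow> \<not> X k" "Y (Suc k) \<longleftrightarrow> \<not> X (Suc k)"
      using full_hook_between[OF u h, of "u k"] full_hook_between[OF u h, of "u (Suc k)"]
      unfolding posu X_def Y_def by auto
    then show ?thesis by simp
  qed simp
  have tele: "(\<Sum>k\<in>{1..<n}. of_bool (a \<le> k \<and> k < b) * (of_bool (Y (Suc k)) - of_bool (Y k))) =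
      (of_bool (Y b) - of_bool (Y a) :: real)" if "a \<le> b" "1 \<le> a" "b \<le> n" for a b
  proof -
    have "(\<Sum>k\<in>{1..<n}. of_bool (a \<le> k \<and> k < b) * (of_bool (Y (Suc k)) - of_bool (Y k) :: real)) =
      (\<Sum>k\<in>{a..<b}. of_bool (Y (Suc k)) - of_bool (Y k))"
      using that by (subst sum_of_bool_eq[of "{1..<n}"]) auto
    also have "\<dots> = of_bool (Y b) - of_bool (Y a)" by (rule sum_Suc_diff'[OF that(1)])
    finally show ?thesis .
  qed
  have Yp: "\<not> Y (inv u p)" "Y (inv u q)"
    using up pq by (auto simp: Y_def permutes_inverses vinv_iff)
  have "(\<Sum>z\<in>asc n w u. rook_up p q (arc u z)) + (\<Sum>z\<in>desc n u. rook_down p q (arc u z)) =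
      (\<Sum>k\<in>{1..<n}. s k * of_bool (X k \<and> Y (Suc k))) + (\<Sum>k\<in>{1..<n}. - s k * of_bool (X (Suc k) \<and> Y k))"
    unfolding sum_asc[OF u] sum_desc[OF u] F G ..
  also have "\<dots> = (\<Sum>k\<in>{1..<n}. s k * (of_bool (Y (Suc k)) - of_bool (Y k)))"
    by (simp only: sum.distrib[symmetric] minus_mult_left[symmetric] add_uminus_conv_diff step)
  also have "\<dots> = 1"
  \<comment> \<open>If \<open>q\<close> stands first, both the sign and the direction of the
    telescoping sum flip.\<close>
  proof (cases "inv u p < inv u q")
    case True
    then have "s k = of_bool (inv u p \<le> k \<and> k < inv u q)" for k by (auto simp: s_def)
    then show ?thesis using tele[of "inv u p" "inv u q"] True posr Yp by simp
  next
    case False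
    then have "s k = - of_bool (inv u q \<le> k \<and> k < inv u p)" for k by (auto simp: s_def)
    then show ?thesis using tele[of "inv u q" "inv u p"] False posr Yp by (simp add: sum_negf)
  qed
  finally show ?thesis .
qed

text \<open>On each descent the indicators are \<open>rook_up\<close> plus \<open>rook_down\<close>.
  Over the orbit the \<open>rook_up\<close> part moves from descents to ascents, and
  \<open>rook_identity\<close> applies to every element.\<close>

lemma full_hook_orbit:
  assumes x: "x \<in> carrier L" and h: "full_hook p q"
  shows "(\<Sum>v\<in>orbit (row L) x. \<Sum>z\<in>desc n v. of_bool (fst z = p) + of_bool (snd z = q)) =
    real (card (orbit (row L) x))"
proof -
  let ?O = "orbit (row L) x"
  have O: "v \<in> carrier L" if "v \<in> ?O" for v
    using orbit_bij_betw(1)[OF bij_row finite_carrier x] that by blast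
  have pq: "(p, q) \<in> vinv n w" using h by (simp add: full_hook_def)
  have eq: "of_bool (fst z = p) + of_bool (snd z = q) = rook_up p q (arc v z) + rook_down p q (arc v z)"
    if "v \<in> ?O" "z \<in> desc n v" for v z
  proof -
    obtain a b where z: "z = (a, b)" by (cases z)
    then have "(a, b) \<in> vinv n w" using desc_subset[OF O[OF that(1)]] that(2) by blast
    then show ?thesis using rook_up_plus_down[OF _ pq] by (simp add: z arc_def)
  qed
  have "(\<Sum>v\<in>?O. \<Sum>z\<in>desc n v. of_bool (fst z = p) + of_bool (snd z = q)) =
      (\<Sum>v\<in>?O. \<Sum>z\<in>desc n v. rook_up p q (arc v z)) + (\<Sum>v\<in>?O. \<Sum>z\<in>desc n v. rook_down p q (arc v z))"
    using eq by (simp add: sum.distrib[symmetric])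
  also have "\<dots> = (\<Sum>v\<in>?O. (\<Sum>z\<in>asc n w v. rook_up p q (arc v z)) + (\<Sum>z\<in>desc n v. rook_down p q (arc v z)))"
    by (simp only: orbit_sum_arcs[OF x] sum.distrib)
  also have "\<dots> = (\<Sum>v\<in>?O. 1)"
    using rook_identity[OF O h] by (intro sum.cong refl) blast
  finally show ?thesis by simp
qed

lemma orbit_sum_desc:
  fixes c :: "nat \<times> nat \<Rightarrow> real"
  assumes x: "x \<in> carrier L"
  shows "(\<Sum>v\<in>orbit (row L) x. \<Sum>z\<in>desc n v. c z) =
    (\<Sum>z\<in>vinv n w. (\<Sum>v\<in>orbit (row L) x. of_bool (z \<in> desc n v)) * c z)"
proof -
  have O: "v \<in> carrier L" if "v \<in> orbit (row L) x" for v
    using orbit_bij_betw(1)[OF bij_row finite_carrier x] that by blast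
  have "(\<Sum>v\<in>orbit (row L) x. \<Sum>z\<in>desc n v. c z) =
      (\<Sum>v\<in>orbit (row L) x. \<Sum>z\<in>vinv n w. of_bool (z \<in> desc n v) * c z)"
    by (intro sum.cong refl sum_of_bool_eq finite_vinv desc_subset O)
  also have "\<dots> = (\<Sum>z\<in>vinv n w. \<Sum>v\<in>orbit (row L) x. of_bool (z \<in> desc n v) * c z)"
    by (rule sum.swap)
  finally show ?thesis by (simp add: sum_distrib_right)
qed

end

section \<open>Antidiagonals of balanced shapes\<close>

text \<open>What is kept of a balanced skew shape inside its rectangle. The list is invariant under
  a half turn, so an argument on one side of the antidiagonal serves for both.\<close>

locale balanced_shape =
  fixes a b :: int and \<tau> :: diagram
  assumes sub: "\<tau> \<subseteq> {1..a} \<times> {1..b}"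
    and row_convex: "(i, j) \<in> \<tau> \<Longrightarrow> (i, l) \<in> \<tau> \<Longrightarrow> j \<le> y \<Longrightarrow> y \<le> l \<Longrightarrow> (i, y) \<in> \<tau>"
    and crossing: "(i, j) \<in> \<tau> \<Longrightarrow> (k, l) \<in> \<tau> \<Longrightarrow> i \<le> k \<Longrightarrow> j \<le> l \<Longrightarrow> (i, l) \<in> \<tau> \<and> (k, j) \<in> \<tau>"
    and shared_column: "1 \<le> p \<Longrightarrow> p < a \<Longrightarrow> \<exists>j. (p, j) \<in> \<tau> \<and> (p + 1, j) \<in> \<tau>"
    and first_row: "\<exists>j. (1, j) \<in> \<tau>" and last_row: "\<exists>j. (a, j) \<in> \<tau>"
    and first_column: "\<exists>i. (i, 1) \<in> \<tau>" and last_column: "\<exists>i. (i, b) \<in> \<tau>"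
    and corner_SE: "(p, q) \<in> \<tau> \<Longrightarrow> (p, q + 1) \<in> \<tau> \<Longrightarrow> (p + 1, q) \<in> \<tau> \<Longrightarrow> (p + 1, q + 1) \<notin> \<tau> \<Longrightarrow>
      p * b + q * a = a * b"
    and corner_NW: "(p, q) \<notin> \<tau> \<Longrightarrow> (p, q + 1) \<in> \<tau> \<Longrightarrow> (p + 1, q) \<in> \<tau> \<Longrightarrow> (p + 1, q + 1) \<in> \<tau> \<Longrightarrow>
      p * b + q * a = a * b"
begin

lemma a_pos: "1 \<le> a" and b_pos: "1 \<le> b"
  using first_row sub by auto

text \<open>\<open>p\<close> is the last row from \<open>i\<close> to \<open>k\<close> that reaches
  column \<open>j\<close> or beyond. The next row ends at some \<open>q < j\<close> but shares a
  column with row \<open>p\<close>, which makes \<open>(p, q)\<close> an outward corner.\<close>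

lemma exists_SE_corner:
  assumes "1 \<le> i" "i < k" "k \<le> a" and i: "(i, y) \<in> \<tau>" "j \<le> y"
    and k: "\<And>y. j \<le> y \<Longrightarrow> (k, y) \<notin> \<tau>"
  obtains p q where "i \<le> p" "p < k" "q < j" "(p + 1, q) \<in> \<tau>"
    "\<And>y. q < y \<Longrightarrow> (p + 1, y) \<notin> \<tau>" "p * b + q * a = a * b"
proof -
  let ?P = "{x \<in> {i..k}. \<exists>y\<ge>j. (x, y) \<in> \<tau>}"
  have fin: "finite ?P" by (rule finite_subset[of _ "{i..k}"]) auto
  have iP: "i \<in> ?P" using assms by auto
  define p where "p = Max ?P"
  have p: "p \<in> ?P" unfolding p_def using fin iP by (intro Max_in) auto
  have p_max: "x \<le> p" if "x \<in> ?P" for x unfolding p_def using fin that by (rule Max_ge)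
  have ip: "i \<le> p" using p_max[OF iP] .
  have "p \<noteq> k" using p k by auto
  then have pk: "p < k" using p by auto
  obtain y1 where y1: "(p, y1) \<in> \<tau>" "j \<le> y1" using p by auto
  have no: "(p + 1, z) \<notin> \<tau>" if "j \<le> z" for z
    using p_max[of "p + 1"] that ip pk by auto
  let ?Q = "{z. (p + 1, z) \<in> \<tau>}"
  have finQ: "finite ?Q" by (rule finite_subset[of _ "{1..b}"]) (use sub in auto)
  obtain s where s: "(p, s) \<in> \<tau>" "(p + 1, s) \<in> \<tau>"
    using shared_column[of p] ip pk assms by auto
  define q where "q = Max ?Q"
  have q: "(p + 1, q) \<in> \<tau>" using Max_in[OF finQ] s by (auto simp: q_def)
  have q_max: "z \<le> q" if "(p + 1, z) \<in> \<tau>" for z unfolding q_def using finQ that by (intro Max_ge) auto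
  have "q < j" using no[of q] q by force
  moreover have "(p, q) \<in> \<tau>" "(p, q + 1) \<in> \<tau>"
    using row_convex[OF s(1) y1(1)] q_max[OF s(2)] y1(2) \<open>q < j\<close> by auto
  moreover have "(p + 1, z) \<notin> \<tau>" if "q < z" for z using q_max[of z] that by auto
  ultimately show ?thesis using that[of p q] ip pk q corner_SE[of p q] by auto
qed

text \<open>A half turn exchanges the two kinds of corners and maps the antidiagonal to
  itself.\<close>

lemma rotate: "balanced_shape a b ((\<lambda>(i, j). (a + 1 - i, b + 1 - j)) ` \<tau>)"
proof -
  let ?f = "\<lambda>(i, j). (a + 1 - i, b + 1 - j)"
  have mem: "(i, j) \<in> ?f ` \<tau> \<longleftrightarrow> (a + 1 - i, b + 1 - j) \<in> \<tau>" for i j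
    by (force simp: image_iff)
  show ?thesis
  proof (unfold_locales, unfold mem)
    show "?f ` \<tau> \<subseteq> {1..a} \<times> {1..b}" using sub by auto
  next
    fix i j l y assume "(a + 1 - i, b + 1 - j) \<in> \<tau>" "(a + 1 - i, b + 1 - l) \<in> \<tau>" "j \<le> y" "y \<le> l"
    then show "(a + 1 - i, b + 1 - y) \<in> \<tau>" using row_convex[of "a + 1 - i" "b + 1 - l" "b + 1 - j"] by auto
  next
    fix i j k l assume "(a + 1 - i, b + 1 - j) \<in> \<tau>" "(a + 1 - k, b + 1 - l) \<in> \<tau>" "i \<le> k" "j \<le> l"
    then show "(a + 1 - i, b + 1 - l) \<in> \<tau> \<and> (a + 1 - k, b + 1 - j) \<in> \<tau>"
      using crossing[of "a + 1 - k" "b + 1 - l" "a + 1 - i" "b + 1 - j"] by auto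
  next
    fix p assume "1 \<le> p" "p < a"
    then obtain j where "(a - p, j) \<in> \<tau>" "(a - p + 1, j) \<in> \<tau>" using shared_column[of "a - p"] by auto
    then show "\<exists>j. (a + 1 - p, b + 1 - j) \<in> \<tau> \<and> (a + 1 - (p + 1), b + 1 - j) \<in> \<tau>"
      by (intro exI[of _ "b + 1 - j"]) (simp add: algebra_simps)
  next
    have flip: "\<exists>j. P (d - j)" if "\<exists>j. P j" for P :: "int \<Rightarrow> bool" and d
      using that by (metis diff_diff_eq2 add_diff_cancel_left')
    show "\<exists>j. (a + 1 - 1, b + 1 - j) \<in> \<tau>" "\<exists>j. (a + 1 - a, b + 1 - j) \<in> \<tau>"
      using flip[OF last_row] flip[OF first_row] by simp_all
    show "\<exists>i. (a + 1 - i, b + 1 - 1) \<in> \<tau>" "\<exists>i. (a + 1 - i, b + 1 - b) \<in> \<tau>"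
      using flip[OF last_column] flip[OF first_column] by simp_all
  next
    fix p q assume "(a + 1 - p, b + 1 - q) \<in> \<tau>" "(a + 1 - p, b + 1 - (q + 1)) \<in> \<tau>"
      "(a + 1 - (p + 1), b + 1 - q) \<in> \<tau>" "(a + 1 - (p + 1), b + 1 - (q + 1)) \<notin> \<tau>"
    then have "(a - p) * b + (b - q) * a = a * b"
      using corner_NW[of "a - p" "b - q"] by (simp add: algebra_simps)
    then show "p * b + q * a = a * b" by (simp add: algebra_simps)
  next
    fix p q assume "(a + 1 - p, b + 1 - q) \<notin> \<tau>" "(a + 1 - p, b + 1 - (q + 1)) \<in> \<tau>"
      "(a + 1 - (p + 1), b + 1 - q) \<in> \<tau>" "(a + 1 - (p + 1), b + 1 - (q + 1)) \<in> \<tau>"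
    then have "(a - p) * b + (b - q) * a = a * b"
      using corner_SE[of "a - p" "b - q"] by (simp add: algebra_simps)
    then show "p * b + q * a = a * b" by (simp add: algebra_simps)
  qed
qed

lemma weight_mono: "p \<le> i \<Longrightarrow> q \<le> j \<Longrightarrow> p * b + q * a \<le> i * b + j * a"
  using a_pos b_pos by (intro add_mono mult_right_mono) auto

text \<open>The northwest corner of the box \<open>(i, j)\<close> lies strictly before the
  antidiagonal. Row \<open>1\<close> reaches column \<open>b\<close>, so without such a
  \<open>y\<close> there would be an outward corner strictly before the antidiagonal.\<close>

lemma exists_right_of:
  assumes i: "1 \<le> i" "i \<le> a" and j: "j \<le> b" and w: "(i - 1) * b + (j - 1) * a < a * b"
  shows "\<exists>y\<ge>j. (i, y) \<in> \<tau>"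
proof (rule ccontr)
  assume no: "\<not> (\<exists>y\<ge>j. (i, y) \<in> \<tau>)"
  obtain x y where "(x, b) \<in> \<tau>" "(1, y) \<in> \<tau>" using last_column first_row by blast
  moreover from this have "1 \<le> x" "y \<le> b" using sub by auto
  ultimately have b1: "(1, b) \<in> \<tau>" using crossing by blast
  then have "1 < i" using no i j by (cases "i = 1") auto
  then obtain p q where pq: "1 \<le> p" "p < i" "q < j" "p * b + q * a = a * b"
    using exists_SE_corner[OF _ _ i(2) b1 j] no by (metis order_refl)
  then show False using weight_mono[of p "i - 1" q "j - 1"] w by linarith
qed

text \<open>The southeast corner of \<open>(i, j)\<close> lies strictly beyond the antidiagonal, and
  a missing box \<open>(i', j')\<close> would create an outward corner weakly southeast of
  it.\<close>

lemma rectangle_SE: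
  assumes ij: "(i, j) \<in> \<tau>" and w: "a * b < i * b + j * a"
    and i': "i \<le> i'" "(i', j) \<in> \<tau>" and j': "j \<le> j'" "(i, j') \<in> \<tau>"
  shows "(i', j') \<in> \<tau>"
proof (rule ccontr)
  assume no: "(i', j') \<notin> \<tau>"
  then have "i < i'" using i' j' by (cases "i = i'") auto
  have no': "(i', y) \<notin> \<tau>" if "j' \<le> y" for y
    using row_convex[OF i'(2), of y j'] that j' no by blast
  have "1 \<le> i" "i' \<le> a" using ij i' sub by auto
  then obtain p q where pq: "i \<le> p" "p < i'" "(p + 1, q) \<in> \<tau>"
    "\<And>y. q < y \<Longrightarrow> (p + 1, y) \<notin> \<tau>" "p * b + q * a = a * b"
    using exists_SE_corner[OF _ \<open>i < i'\<close> _ j'(2) order_refl no'] by metis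
  \<comment> \<open>If row \<open>p + 1\<close> ended left of \<open>j\<close>,
    \<open>crossing\<close> with \<open>(i', j)\<close> would put \<open>(p + 1, j)\<close> into
    it.\<close>
  have "j \<le> q"
  proof (rule ccontr)
    assume "\<not> j \<le> q"
    then show False using crossing[OF pq(3) i'(2)] pq(2,4) by auto
  qed
  then show False using weight_mono[OF pq(1) \<open>j \<le> q\<close>] pq(5) w by linarith
qed

text \<open>The two inequalities say that the antidiagonal passes through the interior of the box.
  Its row has boxes weakly on both sides, so convexity gives the box itself. Of the four quadrants
  around it, \<open>rectangle_SE\<close> and its half turn settle two, \<open>crossing\<close> the
  others.\<close>

lemma antidiagonal_box:
  assumes ij: "1 \<le> i" "i \<le> a" "1 \<le> j" "j \<le> b"
    and w: "(i - 1) * b + (j - 1) * a < a * b" "a * b < i * b + j * a"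
  shows "(i, j) \<in> \<tau>" "(i', j) \<in> \<tau> \<Longrightarrow> (i, j') \<in> \<tau> \<Longrightarrow> (i', j') \<in> \<tau>"
proof -
  interpret r: balanced_shape a b "(\<lambda>(i, j). (a + 1 - i, b + 1 - j)) ` \<tau>" by (rule rotate)
  have mem: "(i, j) \<in> (\<lambda>(i, j). (a + 1 - i, b + 1 - j)) ` \<tau> \<longleftrightarrow> (a + 1 - i, b + 1 - j) \<in> \<tau>" for i j
    by (force simp: image_iff)
  obtain y where y: "j \<le> y" "(i, y) \<in> \<tau>" using exists_right_of ij w by blast
  have "\<exists>y\<ge>b + 1 - j. (a + 1 - (a + 1 - i), b + 1 - y) \<in> \<tau>"
    using r.exists_right_of[of "a + 1 - i" "b + 1 - j", unfolded mem] ij w by (simp add: algebra_simps)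
  then obtain z where "b + 1 - j \<le> z" "(i, b + 1 - z) \<in> \<tau>" by auto
  moreover from this have "b + 1 - z \<le> j" by simp
  ultimately show box: "(i, j) \<in> \<tau>" using row_convex y by blast
  show "(i', j') \<in> \<tau>" if "(i', j) \<in> \<tau>" "(i, j') \<in> \<tau>"
  proof -
    consider "i \<le> i'" "j \<le> j'" | "i' \<le> i" "j' \<le> j" | "i \<le> i'" "j' \<le> j" | "i' \<le> i" "j \<le> j'" by linarith
    then show ?thesis
    proof cases
      case 1
      then show ?thesis using rectangle_SE[OF box w(2)] that by blast
    next
      case 2
      then show ?thesis
        using r.rectangle_SE[of "a + 1 - i" "b + 1 - j" "a + 1 - i'" "b + 1 - j'", unfolded mem]
          box that w(1) by (simp add: algebra_simps)
    next
      case 3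
      then show ?thesis using crossing[OF that(2,1)] by simp
    next
      case 4
      then show ?thesis using crossing[OF that(1,2)] by simp
    qed
  qed
qed

end

section \<open>Skew shapes as instances of the locale\<close>

lemma mem_translate: "(x, y) \<in> translate r c \<sigma> \<longleftrightarrow> (x - r, y - c) \<in> \<sigma>"
  by (force simp: translate_def image_iff)

text \<open>A path in the Hasse diagram passes between two comparable boxes from a row
  \<open>\<le> p\<close> to a later one, and convexity fills rows \<open>p\<close> and
  \<open>p + 1\<close> in the column of the upper box.\<close>

lemma skew_shape_shared_column:
  assumes "is_partition lam" "is_partition nu" "connected_diagram (skew_shape lam nu)"
    and x: "x \<in> skew_shape lam nu" "fst x \<le> p" and y: "y \<in> skew_shape lam nu" "p < fst y"
  shows "\<exists>j. (p, j) \<in> skew_shape lam nu \<and> (p + 1, j) \<in> skew_shape lam nu"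
proof (rule ccontr)
  let ?s = "skew_shape lam nu"
  assume no: "\<not> ?thesis"
  let ?E = "{(u, v). covered_by (box_poset ?s) u v \<or> covered_by (box_poset ?s) v u}"
  have step: "fst v \<le> p" if "(u, v) \<in> ?E" "fst u \<le> p" for u v
  proof (rule ccontr)
    assume gt: "\<not> fst v \<le> p"
    then have uv: "u \<in> ?s" "v \<in> ?s" "fst u \<le> fst v" "snd u \<le> snd v"
      using that by (auto simp: covered_by_def box_poset_def lless_def)
    have "(p, snd u) \<in> ?s" "(p + 1, snd u) \<in> ?s"
      using skew_shape_convex[OF assms(1,2), of "fst u" "snd u" "fst v" "snd v"] uv that(2) gt by auto
    then show False using no by blast
  qed
  have "(x, y) \<in> ?E\<^sup>*" using assms(3) x y by (auto simp: connected_diagram_def)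
  then have "fst y \<le> p" by (induction rule: rtrancl_induct) (use x step in auto)
  then show False using y by simp
qed

text \<open>The outer rows and columns are occupied, since otherwise the shape, shifted by one if
  necessary, would fit into a smaller rectangle.\<close>

lemma balanced_shape_skew_shape:
  assumes lam: "is_partition lam" and nu: "is_partition nu" and bal: "balanced (skew_shape lam nu)"
    and hw: "has_height_width (skew_shape lam nu) a b"
    and rc: "translate r c (skew_shape lam nu) \<subseteq> rectangle a b"
  shows "balanced_shape (int a) (int b) (translate r c (skew_shape lam nu))"
proof -
  let ?s = "skew_shape lam nu"
  let ?t = "translate r c ?s"
  have conn: "connected_diagram ?s" using bal by (simp add: balanced_def)
  then obtain x0 y0 where xy0: "(x0, y0) \<in> ?s" by (auto simp: connected_diagram_def)
  then have xy0t: "(x0 + r, y0 + c) \<in> ?t" by (simp add: mem_translate)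
  have sub: "?t \<subseteq> {1..int a} \<times> {1..int b}" using rc by (simp add: rectangle_def)
  have ab: "1 \<le> a" "1 \<le> b" using xy0t sub by auto
  have min: "a \<le> a' \<and> b \<le> b'" if "translate r' c' ?s \<subseteq> rectangle a' b'" for r' c' a' b'
    using hw that unfolding has_height_width_def by blast
  have corner: "p * int b + q * int a = int a * int b" if "outward_corner ?t (p, q)" for p q
    using bal hw rc that by (auto simp: balanced_def on_antidiagonal_def)
  have first_row: "\<exists>j. (1, j) \<in> ?t"
  proof (rule ccontr)
    assume no: "\<nexists>j. (1, j) \<in> ?t"
    have "translate (r - 1) c ?s \<subseteq> rectangle (a - 1) b"
    proof
      fix z assume "z \<in> translate (r - 1) c ?s"
      then obtain x y where "z = (x - 1, y)" "(x, y) \<in> ?t"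
        by (force simp: translate_def)
      moreover from this have "x \<noteq> 1" using no by auto
      ultimately show "z \<in> rectangle (a - 1) b" using sub ab by (auto simp: rectangle_def)
    qed
    then show False using min ab by fastforce
  qed
  have last_row: "\<exists>j. (int a, j) \<in> ?t"
  proof (rule ccontr)
    assume no: "\<nexists>j. (int a, j) \<in> ?t"
    have "?t \<subseteq> rectangle (a - 1) b"
    proof
      fix z assume z: "z \<in> ?t"
      then have "fst z \<noteq> int a" using no by (cases z) auto
      then show "z \<in> rectangle (a - 1) b" using z sub ab by (cases z) (auto simp: rectangle_def)
    qed
    then show False using min ab by fastforce
  qed
  have first_column: "\<exists>i. (i, 1) \<in> ?t"
  proof (rule ccontr)
    assume no: "\<nexists>i. (i, 1) \<in> ?t"
    have "translate r (c - 1) ?s \<subseteq> rectangle a (b - 1)"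
    proof
      fix z assume "z \<in> translate r (c - 1) ?s"
      then obtain x y where "z = (x, y - 1)" "(x, y) \<in> ?t"
        by (force simp: translate_def)
      moreover from this have "y \<noteq> 1" using no by auto
      ultimately show "z \<in> rectangle a (b - 1)" using sub ab by (auto simp: rectangle_def)
    qed
    then show False using min ab by fastforce
  qed
  have last_column: "\<exists>i. (i, int b) \<in> ?t"
  proof (rule ccontr)
    assume no: "\<nexists>i. (i, int b) \<in> ?t"
    have "?t \<subseteq> rectangle a (b - 1)"
    proof
      fix z assume z: "z \<in> ?t"
      then have "snd z \<noteq> int b" using no by (cases z) auto
      then show "z \<in> rectangle a (b - 1)" using z sub ab by (cases z) (auto simp: rectangle_def)
    qed
    then show False using min ab by fastforce
  qed
  show ?thesis
  proof
    show "?t \<subseteq> {1..int a} \<times> {1..int b}" by (rule sub)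
  next
    fix i j l y assume "(i, j) \<in> ?t" "(i, l) \<in> ?t" "j \<le> y" "y \<le> l"
    then show "(i, y) \<in> ?t"
      using skew_shape_convex[OF lam nu, of "i - r" "j - c" "i - r" "l - c"] by (simp add: mem_translate)
  next
    fix i j k l assume "(i, j) \<in> ?t" "(k, l) \<in> ?t" "i \<le> k" "j \<le> l"
    then show "(i, l) \<in> ?t \<and> (k, j) \<in> ?t"
      using skew_shape_convex[OF lam nu, of "i - r" "j - c" "k - r" "l - c"] by (simp add: mem_translate)
  next
    fix p assume p: "1 \<le> p" "p < int a"
    obtain j1 j2 where "(1, j1) \<in> ?t" "(int a, j2) \<in> ?t" using first_row last_row by blast
    then have "\<exists>j. (p - r, j) \<in> ?s \<and> (p - r + 1, j) \<in> ?s"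
      using p by (intro skew_shape_shared_column[OF lam nu conn, of "(1 - r, j1 - c)" _ "(int a - r, j2 - c)"])
        (auto simp: mem_translate)
    then obtain j where "(p - r, j) \<in> ?s" "(p - r + 1, j) \<in> ?s" by blast
    then show "\<exists>j. (p, j) \<in> ?t \<and> (p + 1, j) \<in> ?t"
      by (intro exI[of _ "j + c"]) (simp add: mem_translate algebra_simps)
  next
    fix p q assume "(p, q) \<in> ?t" "(p, q + 1) \<in> ?t" "(p + 1, q) \<in> ?t" "(p + 1, q + 1) \<notin> ?t"
    then show "p * int b + q * int a = int a * int b"
      by (intro corner) (simp add: outward_corner_iff)
  next
    fix p q assume "(p, q) \<notin> ?t" "(p, q + 1) \<in> ?t" "(p + 1, q) \<in> ?t" "(p + 1, q + 1) \<in> ?t"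
    then show "p * int b + q * int a = int a * int b"
      by (intro corner) (simp add: outward_corner_iff)
  qed (fact first_row last_row first_column last_column)+
qed

section \<open>Cutting the antidiagonal into equal pieces\<close>

text \<open>Pieces are numbered from \<open>0\<close> at the northeast end, so row
  \<open>t div b + 1\<close> contains piece \<open>t\<close> and each row meets a block of
  \<open>b\<close> consecutive pieces. With \<open>a\<close> and \<open>b\<close> exchanged the
  lemma counts the pieces in a column.\<close>

lemma sum_antidiagonal_rows:
  fixes i :: int
  assumes "1 \<le> i" "i \<le> int a"
  shows "(\<Sum>t<a * b. of_bool (int (t div b) + 1 = i)) = real b"
proof -
  obtain k where k: "i = int k + 1" "k < a" using assms by (intro that[of "nat (i - 1)"]) auto
  have "{t \<in> {..<a * b}. int (t div b) + 1 = i} = {k * b..<k * b + b}"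
  proof (cases "b = 0")
    case False
    have le: "k * b + b \<le> a * b" using mult_le_mono1[of "Suc k" a b] k by (simp add: add.commute)
    have dk: "t div b = k \<longleftrightarrow> k * b \<le> t \<and> t < k * b + b" for t
    proof
      assume "t div b = k"
      then show "k * b \<le> t \<and> t < k * b + b"
        using False times_div_less_eq_dividend[of b t] dividend_less_times_div[of b t]
        by (auto simp: mult.commute)
    next
      assume "k * b \<le> t \<and> t < k * b + b"
      then show "t div b = k" by (intro div_nat_eqI) (auto simp: mult.commute)
    qed
    show ?thesis
    proof (rule Set.set_eqI)
      fix t
      have "int (t div b) + 1 = i \<longleftrightarrow> t div b = k" using k by simp
      then show "t \<in> {t \<in> {..<a * b}. int (t div b) + 1 = i} \<longleftrightarrow> t \<in> {k * b..<k * b + b}"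
        using dk[of t] le by auto
    qed
  qed simp
  then show ?thesis by (simp add: of_bool_def sum.If_cases Int_def)
qed

text \<open>For \<open>x = t div b\<close> and \<open>y = t div a\<close>, piece \<open>t\<close>
  crosses the interior of the box \<open>(x + 1, b - y)\<close>. The form \<open>x + 1 - 1\<close>
  matches the hypotheses of \<open>antidiagonal_box\<close>.\<close>

lemma antidiagonal_bounds:
  fixes a b t x y :: int
  assumes "x * b \<le> t" "t < (x + 1) * b" "y * a \<le> t" "t < (y + 1) * a"
  shows "(x + 1 - 1) * b + (b - y - 1) * a < a * b" "a * b < (x + 1) * b + (b - y) * a"
  using assms by (simp_all add: algebra_simps)

text \<open>The row of a box depends only on the larger value \<open>q\<close> and its column only
  on the smaller value \<open>p\<close>, so permuting rows and columns relabels the two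
  separately.\<close>

lemma rothe_diagram_eq:
  assumes w: "w permutes {1..n}"
  shows "rothe_diagram n w = (\<lambda>(p, q). (int (inv w q), int p)) ` vinv n w"
proof (intro equalityI subsetI)
  fix z assume "z \<in> rothe_diagram n w"
  then obtain i j where ij: "z = (int i, int (w j))" "1 \<le> i" "i < j" "j \<le> n" "w j < w i"
    by (auto simp: rothe_diagram_def Inv_def)
  then have "w i \<in> {1..n}" "w j \<in> {1..n}"
    using permutes_in_image[OF w, of i] permutes_in_image[OF w, of j] by auto
  then have "(w j, w i) \<in> vinv n w" using ij by (auto simp: vinv_iff permutes_inverses[OF w])
  then show "z \<in> (\<lambda>(p, q). (int (inv w q), int p)) ` vinv n w"
    using ij by (intro image_eqI[of _ _ "(w j, w i)"]) (auto simp: permutes_inverses[OF w])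
next
  fix z assume "z \<in> (\<lambda>(p, q). (int (inv w q), int p)) ` vinv n w"
  then obtain p q where pq: "z = (int (inv w q), int p)" "(p, q) \<in> vinv n w" by auto
  then have r: "1 \<le> p" "p < q" "q \<le> n" "inv w q < inv w p" by (auto simp: vinv_iff)
  then have "inv w p \<in> {1..n}" "inv w q \<in> {1..n}"
    using pos_in_iff[OF w, of p] pos_in_iff[OF w, of q] by simp_all
  then have "(inv w q, inv w p) \<in> Inv n w"
    using r by (simp add: Inv_def permutes_inverses[OF w])
  then show "z \<in> rothe_diagram n w"
    unfolding rothe_diagram_def pq(1)
    by (intro CollectI exI[of _ "inv w q"] exI[of _ "inv w p"]) (simp add: permutes_inverses[OF w])
qed

section \<open>Averaging over the pieces of the antidiagonal\<close>

theorem corollary1p4: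
  fixes n a b :: nat and w :: "nat \<Rightarrow> nat" and lam nu :: "nat list" and \<sigma> :: diagram
  assumes "is_partition lam" and "is_partition nu" and "\<forall>i. part nu i \<le> part lam i"
    and "\<sigma> = skew_shape lam nu"
    and "balanced \<sigma>" and "has_height_width \<sigma> a b"
    and "w permutes {1..n}" and "skew_vexillary n w \<sigma>"
  shows "mesic (carrier (weak_interval n w)) (row (weak_interval n w))
           (\<lambda>p. real (ddeg (weak_interval n w) p)) (real a * real b / (real a + real b))"
proof -
  interpret weak_initial_interval n w by unfold_locales (rule assms)
  obtain r c where rc: "translate r c \<sigma> \<subseteq> rectangle a b"
    using assms(6) by (auto simp: has_height_width_def)
  define \<tau> where "\<tau> = translate r c \<sigma>"
  interpret balanced_shape "int a" "int b" \<tau>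
    unfolding \<tau>_def assms(4)
    by (rule balanced_shape_skew_shape) (use assms rc in auto)
  obtain f g where fg: "bij f" "bij g" "(\<lambda>(i, j). (f i, g j)) ` rothe_diagram n w = \<sigma>"
    using assms(8) by (auto simp: skew_vexillary_def)
  \<comment> \<open>\<open>R\<close> and \<open>C\<close> send the values \<open>q\<close> and
    \<open>p\<close> to the row and the column of their box in \<open>\<tau>\<close>.\<close>
  define R where "R q = f (int (inv w q)) + r" for q
  define C where "C p = g (int p) + c" for p
  have R_inj: "R x = R y \<longleftrightarrow> x = y" and C_inj: "C x = C y \<longleftrightarrow> x = y" for x y
    using bij_is_inj[OF fg(1)] bij_is_inj[OF fg(2)] pos_eq_iff[OF assms(7)]
    by (auto simp: R_def C_def inj_eq)
  have \<tau>: "\<tau> = (\<lambda>(p, q). (R q, C p)) ` vinv n w"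
    unfolding \<tau>_def fg(3)[symmetric] rothe_diagram_eq[OF assms(7)] translate_def
    by (simp add: image_image case_prod_beta R_def C_def)
  then have \<tau>_iff: "(R q, C p) \<in> \<tau> \<longleftrightarrow> (p, q) \<in> vinv n w" for p q
    by (auto simp: R_inj C_inj)
  have hook: "\<exists>p q. full_hook p q \<and> R q = int (t div b) + 1 \<and> C p = int b - int (t div a)"
    if "t < a * b" for t
  proof -
    have pos: "0 < a" "0 < b" using a_pos b_pos by auto
    have lt: "t div b < a" "t div a < b" using that by (simp_all add: less_mult_imp_div_less mult.commute)
    define x y where "x = int (t div b)" and "y = int (t div a)"
    have "int (t div b * b) \<le> int t" "int t < int ((t div b + 1) * b)"
      "int (t div a * a) \<le> int t" "int t < int ((t div a + 1) * a)"
      unfolding of_nat_le_iff of_nat_less_iff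
      using pos dividend_less_div_times[of b t] dividend_less_div_times[of a t]
      by (simp_all add: add.commute)
    then have "x * int b \<le> int t" "int t < (x + 1) * int b"
      "y * int a \<le> int t" "int t < (y + 1) * int a"
      unfolding x_def y_def by (simp_all only: of_nat_mult of_nat_add of_nat_1)
    note bounds = antidiagonal_bounds[OF this]
    have "1 \<le> x + 1" "x + 1 \<le> int a" "1 \<le> int b - y" "int b - y \<le> int b"
      using lt by (simp_all add: x_def y_def)
    note * = this bounds
    have box: "(x + 1, int b - y) \<in> \<tau>"
      and full: "\<And>i' j'. (i', int b - y) \<in> \<tau> \<Longrightarrow> (x + 1, j') \<in> \<tau> \<Longrightarrow> (i', j') \<in> \<tau>"
      using antidiagonal_box[OF *] by blast+
    from box obtain p q where pq: "(p, q) \<in> vinv n w" "R q = x + 1" "C p = int b - y"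
      by (auto simp: \<tau>)
    then have "full_hook p q"
      using full pq unfolding full_hook_def \<tau>_iff[symmetric] by metis
    then show ?thesis using pq unfolding x_def y_def by blast
  qed
  have mean: "(\<Sum>y\<in>orbit (row L) x. real (ddeg L y)) / real (card (orbit (row L) x)) =
      real a * real b / (real a + real b)" if x: "x \<in> carrier L" for x
  proof -
    let ?O = "orbit (row L) x"
    \<comment> \<open>The number of elements of the orbit that have the descent
      \<open>z\<close>.\<close>
    define N :: "nat \<times> nat \<Rightarrow> real" where "N z = (\<Sum>v\<in>?O. of_bool (z \<in> desc n v))" for z
    have O: "?O \<subseteq> carrier L" by (rule orbit_bij_betw(1)[OF bij_row finite_carrier x])
    have "row L x \<in> ?O" by (rule orbit.base)
    then have card_pos: "0 < card ?O" using finite_subset[OF O finite_carrier] by (auto simp: card_gt_0_iff)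
    have total: "(\<Sum>y\<in>?O. real (ddeg L y)) = (\<Sum>z\<in>vinv n w. N z)"
      using orbit_sum_desc[OF x, of "\<lambda>_. 1"] O ddeg_eq by (simp add: N_def subset_iff)
    have at: "(\<Sum>z\<in>vinv n w. N z * (of_bool (C (fst z) = int b - int (t div a)) +
        of_bool (R (snd z) = int (t div b) + 1))) = real (card ?O)" if "t < a * b" for t
    proof -
      obtain p q where pq: "full_hook p q" "R q = int (t div b) + 1" "C p = int b - int (t div a)"
        using hook[OF \<open>t < a * b\<close>] by blast
      show ?thesis
        using full_hook_orbit[OF x pq(1)]
        unfolding orbit_sum_desc[OF x] pq(2,3)[symmetric] R_inj C_inj N_def .
    qed
    \<comment> \<open>The row of a descent is met by \<open>b\<close> pieces and its column by
      \<open>a\<close>.\<close>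
    have rows: "(\<Sum>t<a * b. of_bool (R (snd z) = int (t div b) + 1)) = real b"
      and cols: "(\<Sum>t<a * b. of_bool (C (fst z) = int b - int (t div a))) = real a"
      if "z \<in> vinv n w" for z
    proof -
      have "(R (snd z), C (fst z)) \<in> \<tau>" using that by (simp add: \<tau>_iff)
      then have bounds: "1 \<le> R (snd z)" "R (snd z) \<le> int a" "1 \<le> C (fst z)" "C (fst z) \<le> int b"
        using sub by auto
      show "(\<Sum>t<a * b. of_bool (R (snd z) = int (t div b) + 1)) = real b"
        using sum_antidiagonal_rows[OF bounds(1,2), of b] by (simp add: eq_commute)
      have "C (fst z) = int b - int (t div a) \<longleftrightarrow> int (t div a) + 1 = int b + 1 - C (fst z)" for t
        by auto
      then show "(\<Sum>t<a * b. of_bool (C (fst z) = int b - int (t div a))) = real a"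
        using sum_antidiagonal_rows[of "int b + 1 - C (fst z)" b a] bounds by (simp add: mult.commute)
    qed
    \<comment> \<open>Double counting: summing \<open>at\<close> over all pieces charges every
      descent \<open>a + b\<close> times.\<close>
    have "real a * real b * real (card ?O) = (\<Sum>t<a * b. real (card ?O))" by simp
    also have "\<dots> = (\<Sum>t<a * b. \<Sum>z\<in>vinv n w. N z * (of_bool (C (fst z) = int b - int (t div a)) +
        of_bool (R (snd z) = int (t div b) + 1)))"
      using at by (intro sum.cong) auto
    also have "\<dots> = (\<Sum>z\<in>vinv n w. N z * ((\<Sum>t<a * b. of_bool (C (fst z) = int b - int (t div a))) +
        (\<Sum>t<a * b. of_bool (R (snd z) = int (t div b) + 1))))"
      by (subst sum.swap) (simp only: sum.distrib[symmetric] sum_distrib_left[symmetric])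
    also have "\<dots> = (\<Sum>z\<in>vinv n w. N z * (real a + real b))"
      using rows cols by (intro sum.cong) auto
    also have "\<dots> = (\<Sum>y\<in>?O. real (ddeg L y)) * (real a + real b)"
      by (simp only: total sum_distrib_right)
    finally show ?thesis using card_pos a_pos by (simp add: field_simps)
  qed
  then show ?thesis using finite_carrier bij_row by (simp add: mesic_def)
qed

end
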